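(* Let $\varphi\in L^2(\mathbb{T})$. A necessary condition for $H_\varphi\in B(H^2,L^\infty)$ is $R_-(\varphi)\in\mathbf{H}^{1/2}(\mathbb{T})$. A sufficient condition for $H_\varphi\in B(H^2,\mathbf{A}_1)\subset B(H^2,L^\infty)$ is $R_-(\varphi)\in\mathbf{H}^1(\mathbb{T})$.
   Context: $\mathbb{T}=\mathbb{R}/2\pi\mathbb{Z}$ with normalized Haar measure $m$; $\widehat f(n)=\int_{\mathbb{T}}f(e^{i\theta})e^{-in\theta}dm(\theta)$. $H^2(\mathbb{T})$ is the set of $f(e^{i\theta})=\sum_{n\ge0}a_ne^{in\theta}$ with $\|f\|_{H^2}^2=\sum|a_n|^2<\infty$. $R_-$ is the orthogonal projection of $L^2(\mathbb{T})$ onto the closed span of $\{e^{in\theta}:n\le0\}$. The Hankel operator with symbol $\varphi\in L^2(\mathbb{T})$ is defined on analytic trigonometric polynomials $f=\sum_{n\ge0}a_ne^{in\theta}$ by $H_\varphi(f)=R_-(\varphi f)=\sum_{k=-\infty}^0\big(\sum_{n=-\infty}^k\widehat\varphi(n)a_{k-n}\big)e^{ik\theta}$. For $s>0$, $\mathbf{H}^s(\mathbb{T})$ is the Sobolev space of $f:\mathbb{T}\to\mathbb{C}$ with $\|f\|^2_{\mathbf{H}^s}=\sum_{n\in\mathbb{Z}}(1+n^2)^s|\widehat f(n)|^2<\infty$. The Wiener space $\mathbf{A}_1(\mathbb{T})\subset L^\infty(\mathbb{T})$ is the set of $f$ with $\|f\|_{\mathbf{A}_1}=\sum_{n\in\mathbb{Z}}|\widehat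 f(n)|<\infty$. $H_\varphi\in B(H^2,Y)$ means that $H_\varphi$ defines (extends to) a bounded operator from $H^2(\mathbb{T})$ to $Y$. *)

theory Defs
  imports "HOL-Probability.Probability"
begin

text \<open>The torus is realised as the unit circle in the complex plane, with \<open>z = cis \<theta>\<close>.
  Functions on it are represented by maps \<^typ>\<open>complex \<Rightarrow> complex\<close>, whose values off the circle
  play no role, and functions that agree almost everywhere are not identified as terms; all the
  notions below are invariant under changing a function on a null set.\<close>

definition circle :: "complex measure" where
  "circle = distr (uniform_measure lborel {0..<2 * pi}) (restrict_space borel (sphere 0 1)) cis"

definition ae_eq :: "(complex \<Rightarrow> complex) \<Rightarrow> (complex \<Rightarrow> complex) \<Rightarrow> bool" where
  "ae_eq f g \<longleftrightarrow> (AE z in circle. f z = g z)"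

definition fourier_coeff :: "(complex \<Rightarrow> complex) \<Rightarrow> int \<Rightarrow> complex" where
  "fourier_coeff f n = (LINT z|circle. f z * z powi (- n))"

definition L1 :: "(complex \<Rightarrow> complex) set" where
  "L1 = {f. integrable circle f}"

definition L2 :: "(complex \<Rightarrow> complex) set" where
  "L2 = {f \<in> borel_measurable circle. integrable circle (\<lambda>z. (cmod (f z))\<^sup>2)}"

definition L2_inner :: "(complex \<Rightarrow> complex) \<Rightarrow> (complex \<Rightarrow> complex) \<Rightarrow> complex" where
  "L2_inner f g = (LINT z|circle. f z * cnj (g z))"

definition L2_norm :: "(complex \<Rightarrow> complex) \<Rightarrow> real" where
  "L2_norm f = sqrt (LINT z|circle. (cmod (f z))\<^sup>2)"

definition Linf_norm :: "(complex \<Rightarrow> complex) \<Rightarrow> real" where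
  "Linf_norm f = real_of_ereal (esssup circle (\<lambda>z. ereal (cmod (f z))))"

definition Linf :: "(complex \<Rightarrow> complex) set" where
  "Linf = {f \<in> borel_measurable circle. esssup circle (\<lambda>z. ereal (cmod (f z))) < \<infinity>}"

definition wiener :: "(complex \<Rightarrow> complex) set" where
  "wiener = {f \<in> L1. (\<lambda>n. cmod (fourier_coeff f n)) summable_on UNIV}"

definition wiener_norm :: "(complex \<Rightarrow> complex) \<Rightarrow> real" where
  "wiener_norm f = (\<Sum>\<^sub>\<infinity>n. cmod (fourier_coeff f n))"

definition sobolev :: "real \<Rightarrow> (complex \<Rightarrow> complex) set" where
  "sobolev s = {f \<in> L1. (\<lambda>n::int. (1 + (real_of_int n)\<^sup>2) powr s * (cmod (fourier_coeff f n))\<^sup>2)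
      summable_on UNIV}"

text \<open>In \<open>H2\<close> the series \<open>\<Sum> a\<^sub>n z\<^sup>n\<close> converges to \<open>f\<close> in the mean of order two, which
  forces \<open>a\<^sub>n\<close> to be the \<open>n\<close>-th Fourier coefficient of \<open>f\<close>.\<close>

definition H2 :: "(complex \<Rightarrow> complex) set" where
  "H2 = {f \<in> L2. \<exists>a :: nat \<Rightarrow> complex. summable (\<lambda>n. (cmod (a n))\<^sup>2) \<and>
      (\<lambda>N. L2_norm (\<lambda>z. f z - (\<Sum>n<N. a n * z ^ n))) \<longlonglongrightarrow> 0}"

definition H2_norm :: "(complex \<Rightarrow> complex) \<Rightarrow> real" where
  "H2_norm f = sqrt (\<Sum>n. (cmod (fourier_coeff f (int n)))\<^sup>2)"

definition analytic_trig_polys :: "(complex \<Rightarrow> complex) set" where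
  "analytic_trig_polys = {\<lambda>z. \<Sum>n<N. a n * z ^ n | (a :: nat \<Rightarrow> complex) N. True}"

definition antianalytic_trig_polys :: "(complex \<Rightarrow> complex) set" where
  "antianalytic_trig_polys =
     {\<lambda>z. \<Sum>n\<in>S. c n * z powi n | (c :: int \<Rightarrow> complex) S. finite S \<and> S \<subseteq> {..0}}"

definition L2_closure :: "(complex \<Rightarrow> complex) set \<Rightarrow> (complex \<Rightarrow> complex) set" where
  "L2_closure V = {f \<in> L2. \<forall>\<epsilon>>0. \<exists>p\<in>V. L2_norm (\<lambda>z. f z - p z) < \<epsilon>}"

definition is_L2_projection ::
    "(complex \<Rightarrow> complex) set \<Rightarrow> (complex \<Rightarrow> complex) \<Rightarrow> (complex \<Rightarrow> complex) \<Rightarrow> bool" where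
  "is_L2_projection V f g \<longleftrightarrow> g \<in> V \<and> (\<forall>h\<in>V. L2_inner (\<lambda>z. f z - g z) h = 0)"

text \<open>The orthogonal projection is only determined almost everywhere; the choice operator picks a
  representative.\<close>

definition R_minus :: "(complex \<Rightarrow> complex) \<Rightarrow> complex \<Rightarrow> complex" where
  "R_minus f = (SOME g. is_L2_projection (L2_closure antianalytic_trig_polys) f g)"

definition hankel :: "(complex \<Rightarrow> complex) \<Rightarrow> (complex \<Rightarrow> complex) \<Rightarrow> complex \<Rightarrow> complex" where
  "hankel \<phi> f = R_minus (\<lambda>z. \<phi> z * f z)"

text \<open>Bounded linear operators between two spaces given by a carrier and a norm. Linearity and
  well-definedness are up to equality almost everywhere.\<close>

definition bounded_operators ::
    "(complex \<Rightarrow> complex) set \<Rightarrow> ((complex \<Rightarrow> complex) \<Rightarrow> real) \<Rightarrow>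
     (complex \<Rightarrow> complex) set \<Rightarrow> ((complex \<Rightarrow> complex) \<Rightarrow> real) \<Rightarrow>
     ((complex \<Rightarrow> complex) \<Rightarrow> (complex \<Rightarrow> complex)) set" where
  "bounded_operators X normX Y normY = {T.
     (\<forall>f\<in>X. T f \<in> Y) \<and>
     (\<forall>f\<in>X. \<forall>g\<in>X. ae_eq f g \<longrightarrow> ae_eq (T f) (T g)) \<and>
     (\<forall>f\<in>X. \<forall>g\<in>X. \<forall>a b. ae_eq (T (\<lambda>z. a * f z + b * g z)) (\<lambda>z. a * T f z + b * T g z)) \<and>
     (\<exists>C. \<forall>f\<in>X. normY (T f) \<le> C * normX f)}"

definition hankel_bounded ::
    "(complex \<Rightarrow> complex) \<Rightarrow> (complex \<Rightarrow> complex) set \<Rightarrow> ((complex \<Rightarrow> complex) \<Rightarrow> real) \<Rightarrow> bool" where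
  "hankel_bounded \<phi> Y normY \<longleftrightarrow>
     (\<exists>T\<in>bounded_operators H2 H2_norm Y normY. \<forall>p\<in>analytic_trig_polys. ae_eq (T p) (hankel \<phi> p))"

end

theory Submission
  imports Defs
begin

text \<open>Write \<open>c\<^sub>n\<close> for the Fourier coefficients of \<open>\<phi>\<close>. The Hankel operator multiplies the coefficient
  sequence of an analytic function by the matrix with entries \<open>c\<close> at \<open>- k - n\<close> (row \<open>k \<ge> 0\<close>,
  column \<open>n \<ge> 0\<close>), so everything depends on the antianalytic part of \<open>\<phi>\<close> only.

  Necessity: a bounded operator from a Hilbert space into \<open>L\<^sup>\<infinity>\<close> of a probability space is
  Hilbert-Schmidt into \<open>L\<^sup>2\<close>. Indeed \<open>\<bar>\<Sum> a\<^sub>n (T e\<^sub>n)(z)\<bar> \<le> C \<parallel>a\<parallel>\<close> holds almost everywhere for each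
  \<open>a\<close>, hence almost everywhere for all \<open>a\<close> in a countable dense set at once, hence
  \<open>\<Sum> \<bar>(T e\<^sub>n)(z)\<bar>\<^sup>2 \<le> C\<^sup>2\<close> almost everywhere, and this integrates (\<open>hilbert_schmidt_bound\<close>). The
  Hilbert-Schmidt norm of the Hankel matrix is computed along antidiagonals: the entry indexed by
  \<open>- m\<close> occurs \<open>m + 1\<close> times, so \<open>\<Sum> (m + 1) \<bar>c\<^bsub>-m\<^esub>\<bar>\<^sup>2\<close> is finite, which is the Sobolev condition of
  order one half.

  Sufficiency: the sum of the moduli of the coefficients of the image of \<open>f\<close> is at most
  \<open>\<Sum>\<^sub>m \<bar>c\<^bsub>-m\<^esub>\<bar> \<Sum>\<^bsub>n\<le>m\<^esub> \<bar>a\<^sub>n\<bar>\<close>. After writing the inner sum as \<open>m + 1\<close> times a mean, the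
  Cauchy-Schwarz inequality and Hardy's inequality (\<open>hardy_inequality\<close>) bound this by
  \<open>2 \<parallel>a\<parallel>\<close> times the square root of \<open>\<Sum> (m + 1)\<^sup>2 \<bar>c\<^bsub>-m\<^esub>\<bar>\<^sup>2\<close>, which is finite under the Sobolev
  condition of order one.

  Two facts of Fourier analysis connect coefficients and functions. An integrable function is
  determined almost everywhere by its coefficients (\<open>fourier_uniqueness\<close>); this identifies the
  constructed extension with the Hankel operator on polynomials, and shows that a function with
  absolutely summable coefficients is almost everywhere the sum of its Fourier series, so that
  the Wiener norm dominates the essential supremum. The Riesz-Fischer theorem (\<open>riesz_fischer\<close>)
  shows that the orthogonal projection defining \<open>R_minus\<close> exists, so that its coefficients are the
  truncated ones.\<close>

section \<open>The unit circle and its monomials\<close>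

lemma cis_measurable_sphere:
  "cis \<in> measurable (uniform_measure lborel {0..<2 * pi}) (restrict_space borel (sphere 0 1))"
proof (rule measurable_restrict_space2)
  show "cis \<in> borel_measurable (uniform_measure lborel {0..<2 * pi})"
    using borel_measurable_continuous_onI[of cis]
    by (simp add: measurable_cong_sets[OF sets_uniform_measure refl] continuous_on_cis[OF continuous_on_id])
qed auto

lemma space_circle [simp]: "space circle = sphere 0 1"
  and sets_circle: "sets circle = sets (restrict_space borel (sphere 0 1))"
  by (simp_all add: circle_def space_restrict_space)

interpretation circle: prob_space circle
proof -
  interpret prob_space "uniform_measure lborel {0..<2 * pi}"
    by (rule prob_space_uniform_measure) auto
  show "prob_space circle"
    unfolding circle_def by (rule prob_space_distr[OF cis_measurable_sphere])
qed

lemma borel_measurable_circle_iff: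
  "borel_measurable circle = borel_measurable (restrict_space borel (sphere 0 1))"
  by (rule measurable_cong_sets[OF sets_circle refl])

lemma borel_measurable_circleI:
  "f \<in> borel_measurable borel \<Longrightarrow> f \<in> borel_measurable circle"
  unfolding borel_measurable_circle_iff
  by (rule measurable_restrict_space1)

lemma ident_measurable_circle [measurable]: "(\<lambda>z. z) \<in> borel_measurable circle"
  by (rule borel_measurable_circleI) simp

lemma powi_measurable [measurable]:
  "(\<lambda>z::complex. z powi n) \<in> borel_measurable circle"
  by (cases "n \<ge> 0") (auto simp: power_int_def intro!: borel_measurable_circleI)

lemma norm_powi_sphere [simp]: "cmod z = 1 \<Longrightarrow> cmod (z powi n) = 1"
  by (simp add: norm_power_int)

lemma cnj_powi_sphere: "cmod z = 1 \<Longrightarrow> cnj (z powi n) = z powi (- n)"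
proof -
  assume z: "cmod z = 1"
  have "cnj z = inverse z"
    using z inverse_unique[of z "cnj z"] by (simp add: complex_norm_square[symmetric])
  then show ?thesis
    by (simp add: power_int_inverse power_int_minus)
qed

lemma integral_circle_eq:
  fixes f :: "complex \<Rightarrow> complex"
  assumes "f \<in> borel_measurable circle"
  shows "(LINT z|circle. f z) = (1 / (2 * pi)) *\<^sub>R (LINT x:{0..<2 * pi}|lborel. f (cis x))"
proof -
  have m: "(\<lambda>x. f (cis x)) \<in> borel_measurable lborel"
    using measurable_compose[OF cis_measurable_sphere assms[unfolded borel_measurable_circle_iff]]
    unfolding measurable_cong_sets[OF sets_uniform_measure[of lborel] refl] .
  have "(LINT z|circle. f z) = (LINT x|uniform_measure lborel {0..<2 * pi}. f (cis x))"
    unfolding circle_def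
    by (rule integral_distr[OF cis_measurable_sphere assms[unfolded borel_measurable_circle_iff]])
  also have "uniform_measure lborel {0..<2 * pi}
      = density lborel (\<lambda>x. ennreal (indicator {0..<2 * pi} x / (2 * pi)))"
    unfolding uniform_measure_def
    by (rule density_cong)
       (auto simp: divide_ennreal[symmetric] ennreal_indicator split: split_indicator)
  also have "(LINT x|density lborel (\<lambda>x. ennreal (indicator {0..<2 * pi} x / (2 * pi))). f (cis x))
     = (LINT x|lborel. (indicator {0..<2 * pi} x / (2 * pi)) *\<^sub>R f (cis x))"
    using m by (intro integral_density) (auto)
  also have "\<dots> = (1 / (2 * pi)) *\<^sub>R (LINT x:{0..<2 * pi}|lborel. f (cis x))"
    unfolding set_lebesgue_integral_def
    by (subst integral_scaleR_right[symmetric])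
       (auto intro!: Bochner_Integration.integral_cong split: split_indicator)
  finally show ?thesis .
qed

lemma integral_powi_circle:
  "(LINT z|circle. z powi n) = (if n = 0 then 1 else 0)"
proof (cases "n = 0")
  case True
  then show ?thesis using circle.prob_space by simp
next
  case False
  define F where "F x = cis (of_int n * x) / (\<i> * of_int n)" for x
  have [measurable]: "(\<lambda>x. cis (of_int n * x)) \<in> borel_measurable borel"
    by (intro borel_measurable_continuous_onI continuous_intros)
  \<comment> \<open>The fundamental theorem of calculus is applied on the closed interval, which differs from
    the half-open one by a null set.\<close>
  have "AE x in lborel. x \<noteq> 2 * pi"
    by (rule AE_lborel_singleton)
  then have "(LINT x:{0..<2 * pi}|lborel. cis x powi n) = (LINT x:{0..2 * pi}|lborel. cis x powi n)"
    unfolding set_lebesgue_integral_def cis_power_int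
    by (intro integral_cong_AE) (auto split: split_indicator)
  also have "\<dots> = F (2 * pi) - F 0"
    unfolding set_lebesgue_integral_def
  proof (rule integral_FTC_atLeastAtMost)
    fix x :: real
    have "((\<lambda>w. exp (\<i> * of_int n * w) / (\<i> * of_int n)) has_field_derivative exp (\<i> * of_int n * of_real x))
        (at (of_real x))"
      using False by (auto intro!: derivative_eq_intros)
    from has_vector_derivative_real_field[OF this, of "{0..2 * pi}"]
    show "(F has_vector_derivative cis x powi n) (at x within {0..2 * pi})"
      unfolding cis_power_int unfolding F_def cis_conv_exp by (simp add: mult.assoc)
  qed (auto simp: cis_power_int intro!: continuous_intros)
  also have "\<dots> = 0"
    using cis_multiple_2pi[of "of_int n"] by (simp add: F_def mult_ac)
  finally show ?thesis
    using False by (simp add: integral_circle_eq)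
qed

section \<open>Fourier coefficients determine an integrable function\<close>

lemma integrable_mult_powi:
  assumes "f \<in> L1"
  shows "integrable circle (\<lambda>z. f z * z powi n)"
proof (rule Bochner_Integration.integrable_bound)
  show "integrable circle f" using assms by (simp add: L1_def)
  then have [measurable]: "f \<in> borel_measurable circle" by auto
  show "(\<lambda>z. f z * z powi n) \<in> borel_measurable circle" by measurable
  show "AE z in circle. cmod (f z * z powi n) \<le> cmod (f z)"
    by (rule AE_I2) (simp add: norm_mult)
qed

lemma fourier_coeff_add:
  "f \<in> L1 \<Longrightarrow> g \<in> L1 \<Longrightarrow> fourier_coeff (\<lambda>z. f z + g z) n = fourier_coeff f n + fourier_coeff g n"
  unfolding fourier_coeff_def by (simp add: integrable_mult_powi distrib_right)

lemma fourier_coeff_diff: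
  "f \<in> L1 \<Longrightarrow> g \<in> L1 \<Longrightarrow> fourier_coeff (\<lambda>z. f z - g z) n = fourier_coeff f n - fourier_coeff g n"
  unfolding fourier_coeff_def by (simp add: integrable_mult_powi left_diff_distrib)

lemma fourier_coeff_cmult:
  "fourier_coeff (\<lambda>z. c * f z) n = c * fourier_coeff f n"
  unfolding fourier_coeff_def by (simp add: mult.assoc)

lemma L1_add: "f \<in> L1 \<Longrightarrow> g \<in> L1 \<Longrightarrow> (\<lambda>z. f z + g z) \<in> L1"
  and L1_diff: "f \<in> L1 \<Longrightarrow> g \<in> L1 \<Longrightarrow> (\<lambda>z. f z - g z) \<in> L1"
  and L1_cmult: "f \<in> L1 \<Longrightarrow> (\<lambda>z. c * f z) \<in> L1"
  and L1_mult_powi: "f \<in> L1 \<Longrightarrow> (\<lambda>z. f z * z powi m) \<in> L1"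
  using integrable_mult_powi by (simp_all add: L1_def)

lemma powi_mult_sphere: "cmod z = 1 \<Longrightarrow> z powi m * z powi n = z powi (m + n)"
  by (subst power_int_add) auto

lemma fourier_coeff_cong:
  "(\<And>z. cmod z = 1 \<Longrightarrow> f z = g z) \<Longrightarrow> fourier_coeff f n = fourier_coeff g n"
  unfolding fourier_coeff_def by (intro Bochner_Integration.integral_cong) auto

lemma L1_cong: "(\<And>z. cmod z = 1 \<Longrightarrow> f z = g z) \<Longrightarrow> f \<in> L1 \<Longrightarrow> g \<in> L1"
  unfolding L1_def using Bochner_Integration.integrable_cong[of circle circle f g] by simp

lemma fourier_coeff_mult_powi:
  "fourier_coeff (\<lambda>z. f z * z powi m) n = fourier_coeff f (n - m)"
  unfolding fourier_coeff_def
  by (intro Bochner_Integration.integral_cong) (auto simp: mult.assoc powi_mult_sphere)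

lemma fourier_coeff_AE_cong:
  assumes "ae_eq f g" "f \<in> borel_measurable circle" "g \<in> borel_measurable circle"
  shows "fourier_coeff f n = fourier_coeff g n"
proof -
  note assms(2,3)[measurable]
  show ?thesis
    unfolding fourier_coeff_def using assms(1)
    by (intro integral_cong_AE) (auto simp: ae_eq_def)
qed

text \<open>On the circle a real-linear functional is \<open>\<alpha> z + cnj \<alpha> / z\<close>, and multiplication by a power of
  \<open>z\<close> shifts the coefficients. The class of integrable functions with vanishing coefficients is
  therefore stable under multiplication by linear functionals, hence by real polynomials in the
  two coordinates.\<close>

lemma vanishing_fourier_polynomial:
  assumes "real_polynomial_function p" "f \<in> L1" "\<And>n. fourier_coeff f n = 0"
  shows "(\<lambda>z. f z * of_real (p z)) \<in> L1 \<and> (\<forall>n. fourier_coeff (\<lambda>z. f z * of_real (p z)) n = 0)"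
  using assms
proof (induction arbitrary: f)
  case (linear p)
  interpret bounded_linear p by fact
  define \<alpha> where "\<alpha> = Complex (p 1 / 2) (- p \<i> / 2)"
  have p: "of_real (p z) = \<alpha> * z powi 1 + cnj \<alpha> * z powi (- 1)" if "cmod z = 1" for z
  proof -
    have "z = Re z *\<^sub>R 1 + Im z *\<^sub>R \<i>"
      by (simp add: complex_eq_iff)
    then have "p z = Re z * p 1 + Im z * p \<i>"
      by (metis add scaleR real_scaleR_def)
    moreover have "z powi (- 1) = cnj z"
      using cnj_powi_sphere[OF that, of 1] by simp
    ultimately show ?thesis
      by (simp add: \<alpha>_def complex_eq_iff)
  qed
  let ?h = "\<lambda>z. \<alpha> * (f z * z powi 1) + cnj \<alpha> * (f z * z powi (- 1))"
  have eq: "f z * of_real (p z) = ?h z" if "cmod z = 1" for z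
    unfolding p[OF that] by (simp add: algebra_simps)
  have "?h \<in> L1"
    using linear.prems by (intro L1_add L1_cmult L1_mult_powi)
  moreover have "fourier_coeff ?h n = 0" for n
    using linear.prems by (subst fourier_coeff_add)
      (auto simp: fourier_coeff_cmult fourier_coeff_mult_powi intro!: L1_cmult L1_mult_powi
            simp del: power_int_1_right power_int_minus1_right)
  ultimately show ?case
    using L1_cong[of ?h "\<lambda>z. f z * of_real (p z)"] fourier_coeff_cong[of "\<lambda>z. f z * of_real (p z)" ?h] eq
    by simp
next
  case (const c)
  then show ?case
    using L1_cmult[of f "of_real c"] fourier_coeff_cmult[of "of_real c" f] by (simp add: mult.commute)
next
  case (add p q)
  then show ?case
    using add.IH(1)[OF add.prems] add.IH(2)[OF add.prems]
    by (simp add: distrib_left L1_add fourier_coeff_add)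
next
  case (mult p q)
  then show ?case
    using mult.IH(2)[of "\<lambda>z. f z * of_real (p z)"] mult.IH(1)[OF mult.prems]
    by (simp add: mult.assoc)
qed

text \<open>The Weierstrass theorem passes from polynomials to continuous functions, because integration
  against \<open>f\<close> is continuous for uniform convergence.\<close>

lemma vanishing_fourier_continuous:
  fixes g :: "complex \<Rightarrow> real"
  assumes f: "f \<in> L1" "\<And>n. fourier_coeff f n = 0" and g: "continuous_on UNIV g"
  shows "(LINT z|circle. f z * of_real (g z)) = 0"
proof -
  have fi: "integrable circle f" using f by (simp add: L1_def)
  have fm [measurable]: "f \<in> borel_measurable circle" using fi by auto
  have gm [measurable]: "g \<in> borel_measurable circle"
    by (intro borel_measurable_circleI borel_measurable_continuous_onI g)
  let ?M = "LINT z|circle. cmod (f z)"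
  have "cmod (LINT z|circle. f z * of_real (g z)) \<le> ?M * e" if "e > 0" for e
  proof -
    obtain p where p: "real_polynomial_function p" "\<And>z. z \<in> sphere 0 1 \<Longrightarrow> \<bar>g z - p z\<bar> < e"
      using Stone_Weierstrass_real_polynomial_function[of "sphere 0 1" g e] g \<open>e > 0\<close>
      by (metis compact_sphere continuous_on_subset top_greatest)
    have fp: "(\<lambda>z. f z * of_real (p z)) \<in> L1" "fourier_coeff (\<lambda>z. f z * of_real (p z)) 0 = 0"
      using vanishing_fourier_polynomial[OF p(1) f] by auto
    have fpi: "integrable circle (\<lambda>z. f z * of_real (p z))"
      using fp by (simp add: L1_def)
    have [measurable]: "(\<lambda>z. f z * of_real (p z)) \<in> borel_measurable circle"
      using fpi by auto
    have bd: "cmod (f z * of_real (g z) - f z * of_real (p z)) \<le> cmod (f z) * e" 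
      if "z \<in> sphere 0 1" for z
      using mult_left_mono[of "\<bar>g z - p z\<bar>" e "cmod (f z)"] p(2)[OF that]
      by (simp flip: right_diff_distrib of_real_diff add: norm_mult)
    have di: "integrable circle (\<lambda>z. f z * of_real (g z) - f z * of_real (p z))"
      by (rule Bochner_Integration.integrable_bound[of _ "\<lambda>z. cmod (f z) * e"])
         (use fi bd \<open>e > 0\<close> in \<open>auto intro!: AE_I2\<close>)
    have "(LINT z|circle. f z * of_real (g z))
        = (LINT z|circle. (f z * of_real (g z) - f z * of_real (p z)) + f z * of_real (p z))"
      by simp
    also have "\<dots> = (LINT z|circle. f z * of_real (g z) - f z * of_real (p z))"
      using fp(2) by (subst Bochner_Integration.integral_add[OF di fpi]) (simp add: fourier_coeff_def)
    finally have "cmod (LINT z|circle. f z * of_real (g z))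
       \<le> (LINT z|circle. cmod (f z * of_real (g z) - f z * of_real (p z)))"
      by simp
    also have "\<dots> \<le> (LINT z|circle. cmod (f z) * e)"
      using fi di bd by (intro integral_mono integrable_norm) auto
    finally show ?thesis by simp
  qed
  note bound = this
  show ?thesis
  proof (rule ccontr)
    assume "(LINT z|circle. f z * of_real (g z)) \<noteq> 0"
    then have pos: "cmod (LINT z|circle. f z * of_real (g z)) > 0" (is "?I > 0") by simp
    define M where "M = ?M"
    have M: "M \<ge> 0" by (simp add: M_def)
    then have "0 < ?I / (2 * (M + 1))"
      using pos by simp
    note bound[OF this, folded M_def]
    also have "M * (?I / (2 * (M + 1))) \<le> ?I / 2"
      using pos M by (simp add: field_simps)
    finally show False using pos by simp
  qed
qed

text \<open>The indicator of a closed set is the pointwise limit of the continuous functions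
  \<open>max 0 (1 - k d(z, K))\<close>, which are dominated by 1.\<close>

lemma vanishing_fourier_closed:
  assumes f: "f \<in> L1" "\<And>n. fourier_coeff f n = 0" and K: "closed K"
  shows "(LINT z|circle. f z * of_real (indicator K z)) = 0"
proof (cases "K = {}")
  case False
  have fi: "integrable circle f" using f by (simp add: L1_def)
  have fm [measurable]: "f \<in> borel_measurable circle" using fi by auto
  define g where "g k z = max 0 (1 - real k * infdist z K)" for k z
  have gc: "continuous_on UNIV (g k)" for k
    unfolding g_def by (intro continuous_intros)
  have [measurable]: "g k \<in> borel_measurable circle" for k
    by (intro borel_measurable_circleI borel_measurable_continuous_onI gc)
  have lim: "(\<lambda>k. g k z) \<longlonglongrightarrow> indicator K z" for z
  proof (cases "z \<in> K")
    case True
    then show ?thesis by (simp add: g_def)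
  next
    case z: False
    then have pos: "infdist z K > 0"
      using in_closed_iff_infdist_zero[OF K False, of z] infdist_nonneg[of z K] by linarith
    obtain k0 where k0: "real k0 * infdist z K > 1"
      using reals_Archimedean3[OF pos] by blast
    have "eventually (\<lambda>k. g k z = 0) sequentially"
    proof (rule eventually_sequentiallyI[of k0])
      fix k assume "k0 \<le> k"
      then have "real k0 * infdist z K \<le> real k * infdist z K"
        using pos by (intro mult_right_mono) auto
      then show "g k z = 0" using k0 by (simp add: g_def)
    qed
    then show ?thesis using z by (simp add: tendsto_eventually)
  qed
  have [measurable]: "(\<lambda>z. indicator K z :: real) \<in> borel_measurable circle"
    using K by (intro borel_measurable_circleI) auto
  have "(\<lambda>k. LINT z|circle. f z * of_real (g k z)) \<longlonglongrightarrow> (LINT z|circle. f z * of_real (indicator K z))"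
  proof (rule integral_dominated_convergence[where w = "\<lambda>z. cmod (f z)"])
    show "AE z in circle. (\<lambda>k. f z * of_real (g k z)) \<longlonglongrightarrow> f z * of_real (indicator K z)"
      by (intro AE_I2 tendsto_intros lim)
    show "AE z in circle. cmod (f z * of_real (g k z)) \<le> cmod (f z)" for k
    proof (rule AE_I2)
      fix z
      have "\<bar>g k z\<bar> \<le> 1" using infdist_nonneg[of z K] by (simp add: g_def)
      then show "cmod (f z * of_real (g k z)) \<le> cmod (f z)"
        by (simp add: norm_mult mult_left_le)
    qed
  qed (use fi in auto)
  moreover have "(LINT z|circle. f z * of_real (g k z)) = 0" for k
    by (rule vanishing_fourier_continuous[OF f gc])
  ultimately show ?thesis
    by (simp add: LIMSEQ_const_iff)
qed simp

text \<open>Closed sets are stable under intersection and generate the Borel sets, so the integral of \<open>f\<close>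
  vanishes over every measurable set.\<close>

theorem fourier_uniqueness:
  assumes f: "f \<in> L1" "\<And>n. fourier_coeff f n = 0"
  shows "AE z in circle. f z = 0"
proof (rule circle.density_zero)
  show fi: "integrable circle f" using f by (simp add: L1_def)
  have mA: "A \<inter> sphere 0 1 \<in> sets circle" if "A \<in> sets borel" for A
    unfolding sets_circle sets_restrict_space using that by (intro image_eqI[of _ _ A]) (simp_all add: Int_commute)
  have si: "set_integrable circle B f" if "B \<in> sets circle" for B
    unfolding set_integrable_def using fi that by (rule integrable_mult_indicator[rotated])
  have int0: "(LINT z:sphere 0 1|circle. f z) = 0"
  proof -
    have "(LINT z:sphere 0 1|circle. f z) = (LINT z|circle. f z)"
      unfolding set_lebesgue_integral_def by (intro Bochner_Integration.integral_cong) auto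
    then show ?thesis using f(2)[of 0] by (simp add: fourier_coeff_def)
  qed
  have "(LINT z:A \<inter> sphere 0 1|circle. f z) = 0" if "A \<in> sets borel" for A
  proof -
    have "Int_stable (Collect closed :: complex set set)"
      by (auto simp: Int_stable_def)
    moreover have "(Collect closed :: complex set set) \<subseteq> Pow UNIV" by simp
    moreover have "A \<in> sigma_sets UNIV (Collect closed)"
      using that unfolding borel_eq_closed by simp
    ultimately show ?thesis
    proof (induction rule: sigma_sets_induct_disjoint)
      case (basic K)
      have "(LINT z:K \<inter> sphere 0 1|circle. f z) = (LINT z|circle. f z * of_real (indicator K z))"
        unfolding set_lebesgue_integral_def
        by (intro Bochner_Integration.integral_cong) (auto split: split_indicator)
      then show ?case using vanishing_fourier_closed[OF f] basic by simp
    next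
      case empty
      then show ?case by (simp add: set_lebesgue_integral_def)
    next
      case (compl B)
      have B: "B \<in> sets borel" using compl(1) unfolding borel_eq_closed by simp
      have "(LINT z:sphere 0 1|circle. f z) 
         = (LINT z:(B \<inter> sphere 0 1) \<union> ((UNIV - B) \<inter> sphere 0 1)|circle. f z)"
        by (rule arg_cong[where f = "\<lambda>X. LINT z:X|circle. f z"]) auto
      also have "\<dots> = (LINT z:B \<inter> sphere 0 1|circle. f z) + (LINT z:(UNIV - B) \<inter> sphere 0 1|circle. f z)"
        using B by (intro set_integral_Un si mA) auto
      finally show ?case using compl int0 by simp
    next
      case (union A)
      have A: "A i \<in> sets borel" for i using union(2) unfolding borel_eq_closed by auto
      have "(LINT z:(\<Union>i. A i \<inter> sphere 0 1)|circle. f z) = (\<Sum>i. LINT z:(A i \<inter> sphere 0 1)|circle. f z)"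
      proof (rule lebesgue_integral_countable_add)
        show "set_integrable circle (\<Union>i. A i \<inter> sphere 0 1) f"
          by (intro si sets.countable_UN) (use mA[OF A] in auto)
        show "A i \<inter> sphere 0 1 \<inter> (A j \<inter> sphere 0 1) = {}" if "i \<noteq> j" for i j
          using union(1) that by (auto simp: disjoint_family_on_def)
      qed (use mA[OF A] in auto)
      moreover have "(\<Union>i. A i \<inter> sphere 0 1) = (\<Union>i. A i) \<inter> sphere 0 1"
        by blast
      ultimately show ?case using union(3) by (simp only: suminf_zero)
    qed
  qed
  note inter = this
  fix A assume "A \<in> sets circle"
  then obtain B where B: "A = sphere 0 1 \<inter> B" "B \<in> sets borel"
    unfolding sets_circle sets_restrict_space by (rule imageE)
  show "(LINT z:A|circle. f z) = 0"
    unfolding B(1) Int_commute[of "sphere 0 1"] by (rule inter[OF B(2)])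
qed

corollary fourier_coeff_inject:
  assumes "f \<in> L1" "g \<in> L1" "\<And>n. fourier_coeff f n = fourier_coeff g n"
  shows "ae_eq f g"
  using fourier_uniqueness[OF L1_diff[OF assms(1,2)]] assms
  by (simp add: ae_eq_def fourier_coeff_diff)

section \<open>Square-integrable functions and the Bessel inequality\<close>

lemma L2_measurable: "f \<in> L2 \<Longrightarrow> f \<in> borel_measurable circle"
  and L2_square_integrable: "f \<in> L2 \<Longrightarrow> integrable circle (\<lambda>z. (cmod (f z))\<^sup>2)"
  by (simp_all add: L2_def)

lemma L1_measurable: "f \<in> L1 \<Longrightarrow> f \<in> borel_measurable circle"
  by (auto simp: L1_def)

lemma L2_mult_integrable:
  assumes "f \<in> L2" "g \<in> L2"
  shows "integrable circle (\<lambda>z. f z * g z)"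
proof (rule Bochner_Integration.integrable_bound)
  note [measurable] = assms[THEN L2_measurable]
  show "integrable circle (\<lambda>z. (cmod (f z))\<^sup>2 + (cmod (g z))\<^sup>2)"
    using assms by (intro Bochner_Integration.integrable_add L2_square_integrable)
  show "(\<lambda>z. f z * g z) \<in> borel_measurable circle" by measurable
  have "cmod (f z) * cmod (g z) \<le> (cmod (f z))\<^sup>2 + (cmod (g z))\<^sup>2" for z
    using sum_squares_bound[of "cmod (f z)" "cmod (g z)"]
      mult_nonneg_nonneg[OF norm_ge_zero[of "f z"] norm_ge_zero[of "g z"]] by linarith
  then show "AE z in circle. norm (f z * g z) \<le> norm ((cmod (f z))\<^sup>2 + (cmod (g z))\<^sup>2)"
    by (simp add: norm_mult)
qed

lemma bounded_in_L2:
  assumes [measurable]: "f \<in> borel_measurable circle" and "\<And>z. cmod z = 1 \<Longrightarrow> cmod (f z) \<le> B"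
  shows "f \<in> L2"
proof -
  have "integrable circle (\<lambda>z. (cmod (f z))\<^sup>2)"
    by (rule circle.integrable_const_bound[of _ "B\<^sup>2"]) (use assms(2) in \<open>auto intro!: AE_I2 power_mono\<close>)
  then show ?thesis by (simp add: L2_def)
qed

lemma L2_const: "(\<lambda>z. c) \<in> L2"
  by (rule bounded_in_L2[of _ "cmod c"]) auto

lemma L2_subset_L1: "f \<in> L2 \<Longrightarrow> f \<in> L1"
  using L2_mult_integrable[OF _ L2_const[of 1]] by (simp add: L1_def)

lemma L2_add:
  assumes "f \<in> L2" "g \<in> L2"
  shows "(\<lambda>z. f z + g z) \<in> L2"
proof -
  note [measurable] = assms[THEN L2_measurable]
  have "integrable circle (\<lambda>z. (cmod (f z + g z))\<^sup>2)"
  proof (rule Bochner_Integration.integrable_bound)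
    show "integrable circle (\<lambda>z. 2 * (cmod (f z))\<^sup>2 + 2 * (cmod (g z))\<^sup>2)"
      using assms by (intro Bochner_Integration.integrable_add integrable_mult_right L2_square_integrable)
    have "(cmod (f z + g z))\<^sup>2 \<le> 2 * (cmod (f z))\<^sup>2 + 2 * (cmod (g z))\<^sup>2" for z
    proof -
      have "(cmod (f z + g z))\<^sup>2 \<le> (cmod (f z) + cmod (g z))\<^sup>2"
        by (intro power_mono norm_triangle_ineq) auto
      also have "\<dots> \<le> 2 * (cmod (f z))\<^sup>2 + 2 * (cmod (g z))\<^sup>2"
        using sum_squares_bound[of "cmod (f z)" "cmod (g z)"] by (simp add: power2_sum)
      finally show ?thesis .
    qed
    then show "AE z in circle. norm ((cmod (f z + g z))\<^sup>2) \<le> norm (2 * (cmod (f z))\<^sup>2 + 2 * (cmod (g z))\<^sup>2)"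
      by simp
  qed measurable
  then show ?thesis by (simp add: L2_def)
qed

lemma L2_mult_bounded:
  assumes "f \<in> L2" and "g \<in> borel_measurable circle" and B: "\<And>z. cmod z = 1 \<Longrightarrow> cmod (g z) \<le> B"
  shows "(\<lambda>z. f z * g z) \<in> L2"
proof -
  note [measurable] = assms(1)[THEN L2_measurable] assms(2)
  have "integrable circle (\<lambda>z. (cmod (f z * g z))\<^sup>2)"
  proof (rule Bochner_Integration.integrable_bound)
    show "integrable circle (\<lambda>z. (cmod (f z))\<^sup>2 * B\<^sup>2)"
      using assms by (intro integrable_mult_left L2_square_integrable)
    show "AE z in circle. norm ((cmod (f z * g z))\<^sup>2) \<le> norm ((cmod (f z))\<^sup>2 * B\<^sup>2)"
      using B by (intro AE_I2) (auto simp: norm_mult power_mult_distrib intro!: mult_left_mono power_mono)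
  qed measurable
  then show ?thesis by (simp add: L2_def)
qed

lemma L2_cmult: "f \<in> L2 \<Longrightarrow> (\<lambda>z. c * f z) \<in> L2"
  using L2_mult_bounded[of f "\<lambda>_. c" "cmod c"] by (simp add: mult.commute)

lemma L2_diff: "f \<in> L2 \<Longrightarrow> g \<in> L2 \<Longrightarrow> (\<lambda>z. f z - g z) \<in> L2"
  using L2_add[of f "\<lambda>z. (-1) * g z"] L2_cmult[of g "-1"] by simp

lemma L2_cnj: "f \<in> L2 \<Longrightarrow> (\<lambda>z. cnj (f z)) \<in> L2"
  using measurable_compose[OF L2_measurable borel_measurable_continuous_onI[of cnj], of f]
  by (simp add: L2_def continuous_on_cnj)

lemma trig_poly_measurable [measurable]:
  fixes c :: "'i \<Rightarrow> complex" and e :: "'i \<Rightarrow> int"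
  shows "(\<lambda>z. \<Sum>i\<in>S. c i * z powi e i) \<in> borel_measurable circle"
  by measurable

lemma trig_poly_bounded:
  fixes c :: "'i \<Rightarrow> complex" and e :: "'i \<Rightarrow> int"
  assumes "cmod z = 1"
  shows "cmod (\<Sum>i\<in>S. c i * z powi e i) \<le> (\<Sum>i\<in>S. cmod (c i))"
  using assms by (intro sum_norm_le) (simp add: norm_mult)

lemma trig_poly_L2:
  fixes c :: "'i \<Rightarrow> complex" and e :: "'i \<Rightarrow> int"
  shows "(\<lambda>z. \<Sum>i\<in>S. c i * z powi e i) \<in> L2"
  by (rule bounded_in_L2[OF trig_poly_measurable trig_poly_bounded])

lemma fourier_coeff_trig_poly:
  fixes c :: "'i \<Rightarrow> complex" and e :: "'i \<Rightarrow> int"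
  shows "fourier_coeff (\<lambda>z. \<Sum>i\<in>S. c i * z powi e i) n = (\<Sum>i\<in>S. if e i = n then c i else 0)"
proof -
  have 1: "(\<lambda>z. 1) \<in> L1" by (rule L2_subset_L1[OF L2_const])
  have "fourier_coeff (\<lambda>z. \<Sum>i\<in>S. c i * z powi e i) n
      = (LINT z|circle. (\<Sum>i\<in>S. c i * z powi (e i - n)))"
    unfolding fourier_coeff_def
    by (intro Bochner_Integration.integral_cong)
       (auto simp: sum_distrib_right mult.assoc powi_mult_sphere)
  also have "\<dots> = (\<Sum>i\<in>S. (LINT z|circle. c i * z powi (e i - n)))"
    using integrable_mult_powi[OF 1] by (intro Bochner_Integration.integral_sum) simp
  also have "\<dots> = (\<Sum>i\<in>S. if e i = n then c i else 0)"
    by (intro sum.cong refl) (simp add: integral_powi_circle)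
  finally show ?thesis .
qed

lemma L2_inner_trig_poly:
  fixes c :: "'i \<Rightarrow> complex" and e :: "'i \<Rightarrow> int"
  assumes "f \<in> L1"
  shows "L2_inner f (\<lambda>z. \<Sum>i\<in>S. c i * z powi e i) = (\<Sum>i\<in>S. cnj (c i) * fourier_coeff f (e i))"
proof -
  have "L2_inner f (\<lambda>z. \<Sum>i\<in>S. c i * z powi e i)
      = (LINT z|circle. (\<Sum>i\<in>S. cnj (c i) * (f z * z powi (- e i))))"
    unfolding L2_inner_def
    by (intro Bochner_Integration.integral_cong)
       (auto simp: sum_distrib_left cnj_powi_sphere mult_ac simp del: complex_cnj_power_int intro!: sum.cong)
  also have "\<dots> = (\<Sum>i\<in>S. (LINT z|circle. cnj (c i) * (f z * z powi (- e i))))"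
    using integrable_mult_powi[OF assms] by (intro Bochner_Integration.integral_sum) simp
  also have "\<dots> = (\<Sum>i\<in>S. cnj (c i) * fourier_coeff f (e i))"
    by (simp add: fourier_coeff_def)
  finally show ?thesis .
qed

lemma L2_norm_square: "(L2_norm f)\<^sup>2 = (LINT z|circle. (cmod (f z))\<^sup>2)"
  by (simp add: L2_norm_def)

lemma L2_norm_nonneg: "0 \<le> L2_norm f"
  by (simp add: L2_norm_def)

lemma L2_norm_square_inner: "complex_of_real ((L2_norm f)\<^sup>2) = L2_inner f f"
  unfolding L2_norm_square L2_inner_def
  by (simp add: complex_norm_square[symmetric] flip: integral_complex_of_real)

text \<open>The family of characters is allowed to be indexed by any injective map, because both all
  integers and the enumeration \<open>k \<mapsto> - k\<close> of the non-positive ones are needed.\<close>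

lemma L2_norm_trig_poly:
  fixes c :: "'i \<Rightarrow> complex" and e :: "'i \<Rightarrow> int"
  assumes "finite S" "inj_on e S"
  shows "(L2_norm (\<lambda>z. \<Sum>i\<in>S. c i * z powi e i))\<^sup>2 = (\<Sum>i\<in>S. (cmod (c i))\<^sup>2)"
proof -
  let ?p = "\<lambda>z. \<Sum>i\<in>S. c i * z powi e i"
  have "fourier_coeff ?p (e i) = c i" if "i \<in> S" for i
  proof -
    have "fourier_coeff ?p (e i) = (\<Sum>j\<in>S. if j = i then c j else 0)"
      unfolding fourier_coeff_trig_poly using that assms(2)
      by (intro sum.cong) (auto simp: inj_on_eq_iff)
    then show ?thesis using that assms(1) by simp
  qed
  then have "complex_of_real ((L2_norm ?p)\<^sup>2) = (\<Sum>i\<in>S. cnj (c i) * c i)"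
    unfolding L2_norm_square_inner L2_inner_trig_poly[OF L2_subset_L1[OF trig_poly_L2]]
    by (intro sum.cong) auto
  also have "\<dots> = complex_of_real (\<Sum>i\<in>S. (cmod (c i))\<^sup>2)"
    by (simp only: of_real_sum complex_norm_square mult.commute)
  finally show ?thesis by (simp only: of_real_eq_iff)
qed

text \<open>The right-hand side minus the left-hand side is the squared distance of \<open>f\<close> to its partial
  Fourier sum.\<close>

lemma bessel_inequality:
  assumes f: "f \<in> L2" and S: "finite S"
  shows "(\<Sum>n\<in>S. (cmod (fourier_coeff f n))\<^sup>2) \<le> (L2_norm f)\<^sup>2"
proof -
  let ?p = "\<lambda>z. \<Sum>n\<in>S. fourier_coeff f n * z powi n"
  let ?s = "\<Sum>n\<in>S. (cmod (fourier_coeff f n))\<^sup>2"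
  have p: "?p \<in> L2" by (rule trig_poly_L2)
  have pn: "(LINT z|circle. (cmod (?p z))\<^sup>2) = ?s"
    using L2_norm_trig_poly[OF S inj_on_id2, of "fourier_coeff f"] by (simp add: L2_norm_square)
  have "L2_inner f ?p = of_real ?s"
    unfolding L2_inner_trig_poly[OF L2_subset_L1[OF f]]
    by (simp only: of_real_sum complex_norm_square mult.commute)
  then have ip: "(LINT z|circle. Re (f z * cnj (?p z))) = ?s"
    using integral_Re[OF L2_mult_integrable[OF f L2_cnj[OF p]]] by (simp add: L2_inner_def)
  have "0 \<le> (LINT z|circle. (cmod (f z - ?p z))\<^sup>2)"
    by simp
  also have "\<dots> = (LINT z|circle. (cmod (f z))\<^sup>2 - 2 * Re (f z * cnj (?p z)) + (cmod (?p z))\<^sup>2)"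
  proof -
    have "(cmod (w - v))\<^sup>2 = (cmod w)\<^sup>2 - 2 * Re (w * cnj v) + (cmod v)\<^sup>2" for v w
      unfolding cmod_power2 by (simp add: power2_eq_square algebra_simps)
    then show ?thesis by (simp only:)
  qed
  also have "\<dots> = (LINT z|circle. (cmod (f z))\<^sup>2) - 2 * ?s + ?s"
    using L2_square_integrable[OF f] L2_square_integrable[OF p] L2_mult_integrable[OF f L2_cnj[OF p]]
    by (subst Bochner_Integration.integral_add, simp_all only: pn ip
        Bochner_Integration.integral_diff Bochner_Integration.integral_mult_right_zero
        integrable_Re integrable_mult_right Bochner_Integration.integrable_diff)
  finally show ?thesis by (simp add: L2_norm_square)
qed

lemma cmod_fourier_coeff_le: "f \<in> L2 \<Longrightarrow> cmod (fourier_coeff f n) \<le> L2_norm f"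
  using bessel_inequality[of f "{n}"] by (auto simp: L2_norm_nonneg intro: power2_le_imp_le)

lemma L2_Cauchy_Schwarz:
  assumes f: "f \<in> L2" and g: "g \<in> L2"
  shows "(LINT z|circle. cmod (f z * g z)) \<le> L2_norm f * L2_norm g"
proof -
  define A F G where "A = (LINT z|circle. cmod (f z * g z))" 
    and "F = (LINT z|circle. (cmod (f z))\<^sup>2)" and "G = (LINT z|circle. (cmod (g z))\<^sup>2)"
  note i = L2_square_integrable[OF f] L2_square_integrable[OF g]
    integrable_norm[OF L2_mult_integrable[OF f g]]
  have nn: "A \<ge> 0" "F \<ge> 0" "G \<ge> 0" by (simp_all add: A_def F_def G_def)
  \<comment> \<open>This is \<open>(s \<bar>f\<bar> - \<bar>g\<bar>)\<^sup>2 \<ge> 0\<close>, integrated.\<close>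
  have q: "0 \<le> s\<^sup>2 * F - 2 * s * A + G" for s
  proof -
    have "0 \<le> (LINT z|circle. (s * cmod (f z) - cmod (g z))\<^sup>2)" by simp
    also have "\<dots> = (LINT z|circle. s\<^sup>2 * (cmod (f z))\<^sup>2 - 2 * s * cmod (f z * g z) + (cmod (g z))\<^sup>2)"
      by (intro Bochner_Integration.integral_cong) (simp_all add: power2_diff norm_mult power_mult_distrib)
    also have "\<dots> = s\<^sup>2 * F - 2 * s * A + G"
      unfolding A_def F_def G_def using i
      by (subst Bochner_Integration.integral_add, simp_all only: Bochner_Integration.integral_diff
          Bochner_Integration.integral_mult_right_zero integrable_mult_right Bochner_Integration.integrable_diff)
    finally show ?thesis .
  qed
  have "A\<^sup>2 \<le> F * G"
  proof (cases "F = 0")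
    case True
    then have "A = 0"
      using q[of "(G + 1) / (2 * A)"] nn by (cases "A = 0") auto
    then show ?thesis using True by simp
  next
    case False
    then have "F > 0" using nn by simp
    then have "0 \<le> F * ((A / F)\<^sup>2 * F - 2 * (A / F) * A + G)"
      using q[of "A / F"] by (intro mult_nonneg_nonneg) auto
    also have "\<dots> = F * G - A\<^sup>2"
      using \<open>F > 0\<close> by (simp add: power2_eq_square field_simps)
    finally show ?thesis by simp
  qed
  then have "A \<le> sqrt (F * G)"
    by (rule real_le_rsqrt)
  then show ?thesis
    by (simp add: A_def F_def G_def L2_norm_def real_sqrt_mult)
qed

corollary cmod_L2_inner_le:
  assumes "f \<in> L2" "g \<in> L2"
  shows "cmod (L2_inner f g) \<le> L2_norm f * L2_norm g"
proof -
  have "cmod (L2_inner f g) \<le> (LINT z|circle. cmod (f z * cnj (g z)))"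
    unfolding L2_inner_def by (rule integral_norm_bound)
  also have "\<dots> \<le> L2_norm f * L2_norm (\<lambda>z. cnj (g z))"
    by (rule L2_Cauchy_Schwarz[OF assms(1) L2_cnj[OF assms(2)]])
  finally show ?thesis by (simp add: L2_norm_def)
qed

section \<open>The Riesz-Fischer theorem and the antianalytic projection\<close>

text \<open>The partial sums are Cauchy in mean square. Along a subsequence the norms of the increments
  are at most \<open>2\<^sup>-\<^sup>j\<close>, so the sum of the increments converges absolutely almost everywhere, and
  Fatou's lemma carries the Cauchy estimate over to the pointwise limit.\<close>

theorem riesz_fischer:
  fixes c :: "nat \<Rightarrow> complex" and e :: "nat \<Rightarrow> int"
  assumes e: "inj e" and c: "summable (\<lambda>k. (cmod (c k))\<^sup>2)"
  shows "\<exists>g\<in>L2. (\<lambda>N. L2_norm (\<lambda>z. g z - (\<Sum>k<N. c k * z powi e k))) \<longlonglongrightarrow> 0"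
proof -
  define S where "S N z = (\<Sum>k<N. c k * z powi e k)" for N z
  define R where "R N = (\<Sum>k. (cmod (c (k + N)))\<^sup>2)" for N
  have [measurable]: "S N \<in> borel_measurable circle" for N
    unfolding S_def by measurable
  have SL2: "S N \<in> L2" for N
    unfolding S_def by (rule trig_poly_L2)
  have R0: "R \<longlonglongrightarrow> 0"
    unfolding R_def by (rule suminf_exist_split2[OF c])
  have diff: "(LINT z|circle. (cmod (S M z - S N z))\<^sup>2) \<le> R N" if "N \<le> M" for M N
  proof -
    have "S M z - S N z = (\<Sum>k\<in>{N..<M}. c k * z powi e k)" for z
      using sum_diff[of "{..<M}" "{..<N}" "\<lambda>k. c k * z powi e k"] that
      by (simp add: S_def lessThan_minus_lessThan)
    then have "(LINT z|circle. (cmod (S M z - S N z))\<^sup>2) = (\<Sum>k\<in>{N..<M}. (cmod (c k))\<^sup>2)"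
      using L2_norm_trig_poly[of "{N..<M}" e c] inj_on_subset[OF e subset_UNIV]
      by (simp add: L2_norm_square)
    also have "\<dots> = (\<Sum>k<M - N. (cmod (c (k + N)))\<^sup>2)"
      using sum.shift_bounds_nat_ivl[of "\<lambda>k. (cmod (c k))\<^sup>2" 0 N "M - N"] that
      by (simp add: atLeast0LessThan)
    also have "\<dots> \<le> R N"
      unfolding R_def using c by (intro sum_le_suminf) (auto intro: summable_ignore_initial_segment)
    finally show ?thesis .
  qed
  have "\<exists>N. \<forall>m\<ge>N. R m \<le> ((1/2) ^ j)\<^sup>2" for j
    using order_tendstoD(2)[OF R0, of "((1/2) ^ j)\<^sup>2"]
    by (force simp: eventually_sequentially)
  then obtain N where N: "\<And>j m. m \<ge> N j \<Longrightarrow> R m \<le> ((1/2) ^ j)\<^sup>2"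
    by metis
  \<comment> \<open>A running sum makes the subsequence monotone, and the summand \<open>j\<close> makes it unbounded.\<close>
  define r where "r j = j + (\<Sum>i\<le>j. N i)" for j
  have r_mono: "r j \<le> r (Suc j)" and r_ge: "j \<le> r j" for j
    by (simp_all add: r_def)
  have rN: "N j \<le> r j" for j
    using member_le_sum[of j "{..j}" N] by (simp add: r_def)
  define D where "D j z = S (r (Suc j)) z - S (r j) z" for j z
  have [measurable]: "D j \<in> borel_measurable circle" for j
    unfolding D_def by measurable
  have DL2: "D j \<in> L2" for j
    unfolding D_def by (intro L2_diff SL2)
  have D1: "(LINT z|circle. cmod (D j z)) \<le> (1/2) ^ j" for j
  proof -
    have "(LINT z|circle. (cmod (D j z))\<^sup>2) \<le> ((1/2) ^ j)\<^sup>2"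
      unfolding D_def using diff[OF r_mono] N[OF rN] by (rule order_trans)
    then have "L2_norm (D j) \<le> (1/2) ^ j"
      unfolding L2_norm_def by (rule real_le_lsqrt[rotated]) simp
    moreover have "(LINT z|circle. cmod (D j z)) \<le> L2_norm (D j)"
      using L2_Cauchy_Schwarz[OF DL2 L2_const[of 1], of j] circle.prob_space by (simp add: L2_norm_def)
    ultimately show ?thesis by simp
  qed
  have "(\<integral>\<^sup>+z. (\<Sum>j. ennreal (cmod (D j z))) \<partial>circle) = (\<Sum>j. \<integral>\<^sup>+z. ennreal (cmod (D j z)) \<partial>circle)"
    by (rule nn_integral_suminf) measurable
  also have "\<dots> = (\<Sum>j. ennreal (LINT z|circle. cmod (D j z)))"
    using DL2 L2_subset_L1 by (intro suminf_cong nn_integral_eq_integral) (auto simp: L1_def)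
  also have "\<dots> \<le> (\<Sum>j. ennreal ((1/2) ^ j))"
    using D1 by (intro suminf_le ennreal_leI) auto
  also have "\<dots> = ennreal (\<Sum>j. (1/2) ^ j)"
    by (intro suminf_ennreal2 summable_geometric) auto
  also have "\<dots> < \<infinity>" by simp
  finally have "(\<integral>\<^sup>+z. (\<Sum>j. ennreal (cmod (D j z))) \<partial>circle) \<noteq> \<infinity>" by simp
  then have "AE z in circle. (\<Sum>j. ennreal (cmod (D j z))) \<noteq> \<infinity>"
    by (intro nn_integral_PInf_AE) measurable
  then have conv: "AE z in circle. convergent (\<lambda>j. S (r j) z)"
  proof eventually_elim
    case (elim z)
    then have "summable (\<lambda>j. cmod (D j z))"
      by (intro summable_suminf_not_top) (auto simp: top_ennreal_def)
    then have "summable (\<lambda>j. D j z)"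
      by (rule summable_norm_cancel)
    then have "(\<lambda>j. (\<Sum>i<j. D i z) + S (r 0) z) \<longlonglongrightarrow> (\<Sum>i. D i z) + S (r 0) z"
      by (intro tendsto_intros summable_LIMSEQ)
    moreover have "(\<Sum>i<j. D i z) + S (r 0) z = S (r j) z" for j
      using sum_lessThan_telescope[of "\<lambda>j. S (r j) z" j] by (simp add: D_def)
    ultimately show ?case by (auto simp: convergent_def)
  qed
  define g where "g z = lim (\<lambda>j. S (r j) z)" for z
  have [measurable]: "g \<in> borel_measurable circle"
    unfolding g_def by (rule borel_measurable_lim_metric) measurable
  have bound: "(\<integral>\<^sup>+z. ennreal ((cmod (g z - S M z))\<^sup>2) \<partial>circle) \<le> ennreal (R M)" for M
  proof -
    have "(\<integral>\<^sup>+z. ennreal ((cmod (g z - S M z))\<^sup>2) \<partial>circle)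
        = (\<integral>\<^sup>+z. liminf (\<lambda>j. ennreal ((cmod (S (r j) z - S M z))\<^sup>2)) \<partial>circle)"
    proof (rule nn_integral_cong_AE, use conv in eventually_elim)
      case (elim z)
      then have "(\<lambda>j. S (r j) z) \<longlonglongrightarrow> g z"
        by (simp add: g_def convergent_LIMSEQ_iff)
      then have "(\<lambda>j. ennreal ((cmod (S (r j) z - S M z))\<^sup>2)) \<longlonglongrightarrow> ennreal ((cmod (g z - S M z))\<^sup>2)"
        by (intro tendsto_intros)
      then show ?case
        by (rule lim_imp_Liminf[OF sequentially_bot, symmetric])
    qed
    also have "\<dots> \<le> liminf (\<lambda>j. \<integral>\<^sup>+z. ennreal ((cmod (S (r j) z - S M z))\<^sup>2) \<partial>circle)"
      by (rule nn_integral_liminf) measurable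
    also have "\<dots> \<le> ennreal (R M)"
    proof (rule Liminf_le)
      show "\<forall>\<^sub>F j in sequentially. (\<integral>\<^sup>+z. ennreal ((cmod (S (r j) z - S M z))\<^sup>2) \<partial>circle) \<le> ennreal (R M)"
      proof (rule eventually_sequentiallyI[of M])
        fix j assume "M \<le> j"
        then have "M \<le> r j" using r_ge[of j] by simp
        then show "(\<integral>\<^sup>+z. ennreal ((cmod (S (r j) z - S M z))\<^sup>2) \<partial>circle) \<le> ennreal (R M)"
          using L2_square_integrable[OF L2_diff[OF SL2 SL2], of "r j" M] diff[of M "r j"]
          by (subst nn_integral_eq_integral) (auto intro: ennreal_leI)
      qed
    qed simp
    finally show ?thesis .
  qed
  have L2: "(\<lambda>z. g z - S M z) \<in> L2" for M
  proof -
    have "integrable circle (\<lambda>z. (cmod (g z - S M z))\<^sup>2)"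
      using bound[of M] by (intro integrableI_bounded) (auto intro: le_less_trans)
    then show ?thesis by (simp add: L2_def)
  qed
  have "(LINT z|circle. (cmod (g z - S M z))\<^sup>2) \<le> R M" for M
  proof -
    have "R M \<ge> 0" unfolding R_def using c by (intro suminf_nonneg) (auto intro: summable_ignore_initial_segment)
    then show ?thesis
      using bound[of M] L2_square_integrable[OF L2, of M] by (subst (asm) nn_integral_eq_integral) auto
  qed
  then have le: "L2_norm (\<lambda>z. g z - S M z) \<le> sqrt (R M)" for M
    unfolding L2_norm_def by simp
  have "(\<lambda>M. L2_norm (\<lambda>z. g z - S M z)) \<longlonglongrightarrow> 0"
  proof (rule tendsto_sandwich[of "\<lambda>_. 0"])
    show "(\<lambda>M. sqrt (R M)) \<longlonglongrightarrow> 0"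
      using tendsto_real_sqrt[OF R0] by simp
  qed (auto simp: le L2_norm_nonneg)
  moreover have "g \<in> L2"
    using L2[of 0] by (simp add: S_def)
  ultimately show ?thesis
    unfolding S_def by blast
qed

text \<open>By the Cauchy-Schwarz inequality the inner product with \<open>u\<close> is continuous in mean square, so
  orthogonality passes to the closure.\<close>

lemma L2_closure_inner_zero:
  assumes u: "u \<in> L2" and V: "V \<subseteq> L2" "\<And>p. p \<in> V \<Longrightarrow> L2_inner u p = 0" and h: "h \<in> L2_closure V"
  shows "L2_inner u h = 0"
proof (rule ccontr)
  assume "L2_inner u h \<noteq> 0"
  then have pos: "cmod (L2_inner u h) > 0" by simp
  have hL2: "h \<in> L2" using h by (simp add: L2_closure_def)
  define \<epsilon> where "\<epsilon> = cmod (L2_inner u h) / (L2_norm u + 1)"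
  have n1: "L2_norm u + 1 > 0" using L2_norm_nonneg[of u] by simp
  then have "\<epsilon> > 0" using pos by (simp add: \<epsilon>_def)
  then obtain p where p: "p \<in> V" "L2_norm (\<lambda>z. h z - p z) < \<epsilon>"
    using h by (auto simp: L2_closure_def)
  have pL2: "p \<in> L2" using p V by auto
  have "L2_inner u (\<lambda>z. h z - p z) = L2_inner u h - L2_inner u p"
    unfolding L2_inner_def
    using L2_mult_integrable[OF u L2_cnj[OF hL2]] L2_mult_integrable[OF u L2_cnj[OF pL2]]
    by (simp add: right_diff_distrib)
  then have "cmod (L2_inner u h) \<le> L2_norm u * L2_norm (\<lambda>z. h z - p z)"
    using cmod_L2_inner_le[OF u L2_diff[OF hL2 pL2]] V(2)[OF p(1)] by simp
  also have "\<dots> \<le> L2_norm u * \<epsilon>"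
    using p(2) L2_norm_nonneg by (intro mult_left_mono) auto
  also have "\<dots> < (L2_norm u + 1) * \<epsilon>"
    using \<open>\<epsilon> > 0\<close> by simp
  also have "\<dots> = cmod (L2_inner u h)"
    using n1 by (simp add: \<epsilon>_def)
  finally show False by simp
qed

lemma antianalytic_trig_polysI:
  "finite S \<Longrightarrow> S \<subseteq> {..0} \<Longrightarrow> (\<lambda>z. \<Sum>n\<in>S. c n * z powi n) \<in> antianalytic_trig_polys"
  unfolding antianalytic_trig_polys_def by blast

lemma antianalytic_trig_polys_L2: "antianalytic_trig_polys \<subseteq> L2"
  unfolding antianalytic_trig_polys_def using trig_poly_L2[of _ "\<lambda>n. n"] by auto

lemma L2_inner_powi: "f \<in> L1 \<Longrightarrow> L2_inner f (\<lambda>z. z powi n) = fourier_coeff f n"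
  using L2_inner_trig_poly[of f "\<lambda>_. 1" "\<lambda>n. n" "{n}"] by simp

text \<open>The Bessel inequality makes the coefficients of \<open>f\<close> of non-positive index square-summable. The
  function that the Riesz-Fischer theorem attaches to them is a limit of antianalytic polynomials
  and has the same coefficients of non-positive index as \<open>f\<close>, so the difference is orthogonal to
  the whole closure.\<close>

lemma R_minus_projection_exists:
  assumes f: "f \<in> L2"
  shows "\<exists>g. is_L2_projection (L2_closure antianalytic_trig_polys) f g"
proof -
  define c where "c k = fourier_coeff f (- int k)" for k
  have "summable (\<lambda>k. (cmod (c k))\<^sup>2)"
  proof (rule summableI_nonneg_bounded)
    show "(\<Sum>k<N. (cmod (c k))\<^sup>2) \<le> (L2_norm f)\<^sup>2" for N
      using bessel_inequality[OF f, of "(\<lambda>k. - int k) ` {..<N}"]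
      by (simp add: sum.reindex c_def inj_on_def)
  qed simp
  moreover have "inj (\<lambda>k. - int k)" by (auto simp: inj_def)
  ultimately obtain g where g: "g \<in> L2"
      "(\<lambda>N. L2_norm (\<lambda>z. g z - (\<Sum>k<N. c k * z powi (- int k)))) \<longlonglongrightarrow> 0"
    using riesz_fischer by blast
  have anti: "(\<lambda>z. \<Sum>k<N. c k * z powi (- int k)) \<in> antianalytic_trig_polys" for N
  proof -
    have eq: "(\<lambda>z. \<Sum>k<N. c k * z powi (- int k))
        = (\<lambda>z. \<Sum>n\<in>(\<lambda>k. - int k) ` {..<N}. fourier_coeff f n * z powi n)"
      by (subst sum.reindex) (auto simp: c_def inj_on_def)
    show ?thesis
      unfolding eq by (rule antianalytic_trig_polysI) auto
  qed
  have gV: "g \<in> L2_closure antianalytic_trig_polys"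
    unfolding L2_closure_def
  proof (safe intro!: g(1))
    fix \<epsilon> :: real assume "0 < \<epsilon>"
    then obtain N where "L2_norm (\<lambda>z. g z - (\<Sum>k<N. c k * z powi (- int k))) < \<epsilon>"
      using order_tendstoD(2)[OF g(2)] by (auto simp: eventually_sequentially)
    then show "\<exists>p\<in>antianalytic_trig_polys. L2_norm (\<lambda>z. g z - p z) < \<epsilon>"
      by (rule bexI[OF _ anti[of N]])
  qed
  have gc: "fourier_coeff g (- int m) = c m" for m
  proof -
    have "\<forall>\<^sub>F N in sequentially. cmod (fourier_coeff g (- int m) - c m)
        \<le> L2_norm (\<lambda>z. g z - (\<Sum>k<N. c k * z powi (- int k)))"
    proof (rule eventually_sequentiallyI[of "Suc m"])
      fix N assume "Suc m \<le> N"
      then have "fourier_coeff (\<lambda>z. \<Sum>k<N. c k * z powi (- int k)) (- int m) = c m"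
        by (simp add: fourier_coeff_trig_poly)
      then show "cmod (fourier_coeff g (- int m) - c m)
        \<le> L2_norm (\<lambda>z. g z - (\<Sum>k<N. c k * z powi (- int k)))"
        using cmod_fourier_coeff_le[OF L2_diff[OF g(1) trig_poly_L2], of c "\<lambda>k. - int k" "{..<N}" "- int m"]
        by (simp add: fourier_coeff_diff L2_subset_L1 g(1) trig_poly_L2)
    qed
    from tendsto_lowerbound[OF g(2) this] show ?thesis by simp
  qed
  have u: "(\<lambda>z. f z - g z) \<in> L2" by (rule L2_diff[OF f g(1)])
  have u0: "fourier_coeff (\<lambda>z. f z - g z) n = 0" if "n \<le> 0" for n
    using gc[of "nat (- n)"] that f g(1)
    by (simp add: fourier_coeff_diff L2_subset_L1 c_def)
  have "L2_inner (\<lambda>z. f z - g z) h = 0" if "h \<in> L2_closure antianalytic_trig_polys" for h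
  proof (rule L2_closure_inner_zero[OF u antianalytic_trig_polys_L2 _ that])
    fix p assume "p \<in> antianalytic_trig_polys"
    then obtain c S where p: "p = (\<lambda>z. \<Sum>n\<in>S. c n * z powi n)" "S \<subseteq> {..0}"
      unfolding antianalytic_trig_polys_def by blast
    show "L2_inner (\<lambda>z. f z - g z) p = 0"
      unfolding p(1) L2_inner_trig_poly[OF L2_subset_L1[OF u]]
      using p(2) u0 by (intro sum.neutral) auto
  qed
  with gV show ?thesis
    unfolding is_L2_projection_def by blast
qed

text \<open>Testing the projection property against a monomial of non-positive degree gives the equality of
  coefficients; monomials of positive degree are orthogonal to the closed span.\<close>

lemma
  assumes f: "f \<in> L2"
  shows R_minus_L2: "R_minus f \<in> L2"
    and fourier_coeff_R_minus: "fourier_coeff (R_minus f) n = (if n \<le> 0 then fourier_coeff f n else 0)"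
proof -
  let ?V = "L2_closure antianalytic_trig_polys"
  have "is_L2_projection ?V f (R_minus f)"
    unfolding R_minus_def by (rule someI_ex[OF R_minus_projection_exists[OF f]])
  then have g: "R_minus f \<in> ?V" and orth: "\<And>h. h \<in> ?V \<Longrightarrow> L2_inner (\<lambda>z. f z - R_minus f z) h = 0"
    by (auto simp: is_L2_projection_def)
  show gL2: "R_minus f \<in> L2" using g by (simp add: L2_closure_def)
  have powi_L2: "(\<lambda>z. z powi m) \<in> L2" for m
    using trig_poly_L2[of "\<lambda>_. 1" "\<lambda>n. n" "{m}"] by simp
  show "fourier_coeff (R_minus f) n = (if n \<le> 0 then fourier_coeff f n else 0)"
  proof (cases "n \<le> 0")
    case True
    have "(\<lambda>z. z powi n) \<in> antianalytic_trig_polys"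
      using antianalytic_trig_polysI[of "{n}" "\<lambda>_. 1"] True by simp
    moreover have "L2_norm (\<lambda>z. 0) = 0" by (simp add: L2_norm_def)
    ultimately have "(\<lambda>z. z powi n) \<in> ?V"
      unfolding L2_closure_def using powi_L2 by (auto intro!: bexI[of _ "\<lambda>z. z powi n"])
    from orth[OF this] show ?thesis
      using True f gL2 by (simp add: L2_inner_powi L1_diff L2_subset_L1 fourier_coeff_diff)
  next
    case False
    have "L2_inner (\<lambda>z. z powi n) (R_minus f) = 0"
    proof (rule L2_closure_inner_zero[OF powi_L2 antianalytic_trig_polys_L2 _ g])
      fix p assume "p \<in> antianalytic_trig_polys"
      then obtain c S where p: "p = (\<lambda>z. \<Sum>n\<in>S. c n * z powi n)" "S \<subseteq> {..0}"
        unfolding antianalytic_trig_polys_def by blast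
      have "fourier_coeff (\<lambda>z. z powi n) m = (if n = m then 1 else 0)" for m
        using fourier_coeff_trig_poly[of "\<lambda>_. 1" "\<lambda>n. n" "{n}" m] by simp
      then show "L2_inner (\<lambda>z. z powi n) p = 0"
        unfolding p(1) L2_inner_trig_poly[OF L2_subset_L1[OF powi_L2]]
        using p(2) False by (intro sum.neutral) auto
    qed
    moreover have "L2_inner (R_minus f) (\<lambda>z. z powi n) = cnj (L2_inner (\<lambda>z. z powi n) (R_minus f))"
      unfolding L2_inner_def
      by (subst Bochner_Integration.integral_cnj[symmetric]) (simp add: mult.commute)
    ultimately show ?thesis
      using False L2_inner_powi[OF L2_subset_L1[OF gL2]] by simp
  qed
qed

section \<open>Absolutely convergent Fourier series and essential bounds\<close>

text \<open>The sum over all integers is arranged as an ordinary series along an enumeration of the integers,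
  so that measurability and termwise integration of series apply; for absolutely summable
  coefficients the arrangement does not change the value.\<close>

definition wiener_series :: "(int \<Rightarrow> complex) \<Rightarrow> complex \<Rightarrow> complex" where
  "wiener_series c z = (\<Sum>j. c (int_decode j) * z powi int_decode j)"

lemma summable_int_decode:
  fixes c :: "int \<Rightarrow> real"
  assumes "c summable_on UNIV" "\<And>n. 0 \<le> c n"
  shows "summable (\<lambda>j. c (int_decode j))" 
    and "(\<Sum>j. c (int_decode j)) = (\<Sum>\<^sub>\<infinity>n. c n)"
proof -
  have "(\<lambda>j. c (int_decode j)) summable_on UNIV"
    using summable_on_reindex_bij_betw[OF bij_int_decode, of c] assms by simp
  then show *: "summable (\<lambda>j. c (int_decode j))"
    using assms by (simp add: summable_on_UNIV_nonneg_real_iff)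
  have "((\<lambda>j. c (int_decode j)) has_sum (\<Sum>j. c (int_decode j))) UNIV"
    using * assms by (intro norm_summable_imp_has_sum) (auto intro: summable_sums)
  then show "(\<Sum>j. c (int_decode j)) = (\<Sum>\<^sub>\<infinity>n. c n)"
    using infsum_reindex_bij_betw[OF bij_int_decode, of c] by (simp add: infsumI)
qed

lemma wiener_series_measurable [measurable]: "wiener_series c \<in> borel_measurable circle"
  unfolding wiener_series_def by measurable

lemma cmod_wiener_series_le:
  assumes c: "(\<lambda>n. cmod (c n)) summable_on UNIV" and z: "cmod z = 1"
  shows "cmod (wiener_series c z) \<le> (\<Sum>\<^sub>\<infinity>n. cmod (c n))"
proof -
  have "norm (\<Sum>j. c (int_decode j) * z powi int_decode j) \<le> (\<Sum>j. cmod (c (int_decode j)))"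
    using summable_int_decode(1)[OF c] z by (intro norm_suminf_le) (auto simp: norm_mult)
  then show ?thesis
    using summable_int_decode(2)[OF c] by (simp add: wiener_series_def)
qed

lemma wiener_series_L1:
  assumes c: "(\<lambda>n. cmod (c n)) summable_on UNIV"
  shows "wiener_series c \<in> L1"
  by (rule L2_subset_L1, rule bounded_in_L2) (auto intro: cmod_wiener_series_le[OF c])

lemma fourier_coeff_wiener_series:
  assumes c: "(\<lambda>n. cmod (c n)) summable_on UNIV"
  shows "fourier_coeff (wiener_series c) n = c n"
proof -
  note s = summable_int_decode(1)[OF c norm_ge_zero]
  define F where "F j z = c (int_decode j) * z powi (int_decode j - n)" for j and z :: complex
  have Fi: "integrable circle (F j)" for j
    using integrable_mult_powi[OF L2_subset_L1[OF L2_const], of "c (int_decode j)"]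
    unfolding F_def by simp
  have Fn: "cmod (F j z) = cmod (c (int_decode j))" if "cmod z = 1" for j z
    using that by (simp add: F_def norm_mult)
  have norms: "(LINT z|circle. cmod (F j z)) = cmod (c (int_decode j))" for j
  proof -
    have "(LINT z|circle. cmod (F j z)) = (LINT z|circle. cmod (c (int_decode j)))"
      by (intro Bochner_Integration.integral_cong) (auto simp: Fn)
    then show ?thesis using circle.prob_space by simp
  qed
  have ints: "(LINT z|circle. F j z) = (if j = int_encode n then c n else 0)" for j
    by (auto simp: F_def integral_powi_circle)
  have "fourier_coeff (wiener_series c) n = (LINT z|circle. (\<Sum>j. F j z))"
    unfolding fourier_coeff_def
  proof (intro Bochner_Integration.integral_cong refl)
    fix z assume "z \<in> space circle"
    then have z: "cmod z = 1" by simp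
    have "summable (\<lambda>j. c (int_decode j) * z powi int_decode j)"
      by (rule summable_norm_cancel) (use s z in \<open>simp add: norm_mult\<close>)
    then have "wiener_series c z * z powi (- n) = (\<Sum>j. c (int_decode j) * z powi int_decode j * z powi (- n))"
      unfolding wiener_series_def by (rule suminf_mult2)
    also have "\<dots> = (\<Sum>j. F j z)"
      by (simp add: F_def mult.assoc powi_mult_sphere[OF z])
    finally show "wiener_series c z * z powi (- n) = (\<Sum>j. F j z)" .
  qed
  also have "\<dots> = (\<Sum>j. LINT z|circle. F j z)"
    using Fi s by (intro integral_suminf) (auto simp: norms Fn intro!: AE_I2)
  also have "\<dots> = c n"
    unfolding ints using sums_unique[OF sums_single[of "int_encode n" "\<lambda>_. c n"]] by simp
  finally show ?thesis .
qed

lemma wiener_series_wiener: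
  assumes c: "(\<lambda>n. cmod (c n)) summable_on UNIV"
  shows "wiener_series c \<in> wiener" "wiener_norm (wiener_series c) = (\<Sum>\<^sub>\<infinity>n. cmod (c n))"
  using c wiener_series_L1[OF c] by (simp_all add: wiener_def wiener_norm_def fourier_coeff_wiener_series)

text \<open>By uniqueness \<open>f\<close> agrees almost everywhere with the sum of its Fourier series, and that series is
  bounded by the sum of the moduli of its coefficients.\<close>

lemma wiener_AE_bound:
  assumes f: "f \<in> wiener"
  shows "AE z in circle. cmod (f z) \<le> wiener_norm f"
proof -
  have c: "(\<lambda>n. cmod (fourier_coeff f n)) summable_on UNIV" and "f \<in> L1"
    using f by (auto simp: wiener_def)
  then have "ae_eq f (wiener_series (fourier_coeff f))"
    by (intro fourier_coeff_inject wiener_series_L1) (simp_all add: fourier_coeff_wiener_series)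
  moreover have "AE z in circle. cmod (wiener_series (fourier_coeff f) z) \<le> wiener_norm f"
    unfolding wiener_norm_def using cmod_wiener_series_le[OF c] by (intro AE_I2) simp
  ultimately show ?thesis
    unfolding ae_eq_def by eventually_elim simp
qed

lemma
  assumes f: "f \<in> borel_measurable circle" and B: "AE z in circle. cmod (f z) \<le> B"
  shows LinfI: "f \<in> Linf" and Linf_norm_le: "Linf_norm f \<le> B"
proof -
  note [measurable] = f
  have le: "esssup circle (\<lambda>z. ereal (cmod (f z))) \<le> ereal B"
    using B by (intro esssup_I) auto
  show "f \<in> Linf" using f le by (auto simp: Linf_def)
  have "B \<ge> 0"
  proof -
    \<comment> \<open>A probability space is not null, so an almost sure upper bound of a modulus is non-negative.\<close>
    have "AE z in circle. B \<ge> 0"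
      using B by (rule eventually_mono) (meson norm_ge_zero order_trans)
    then show ?thesis by (simp add: circle.AE_const)
  qed
  then show "Linf_norm f \<le> B"
    using le unfolding Linf_norm_def by (cases "esssup circle (\<lambda>z. ereal (cmod (f z)))") auto
qed

lemma Linf_AE_bound:
  assumes f: "f \<in> Linf"
  shows "AE z in circle. cmod (f z) \<le> Linf_norm f"
proof -
  have fin: "esssup circle (\<lambda>z. ereal (cmod (f z))) < \<infinity>"
    using f by (simp add: Linf_def)
  have "AE z in circle. ereal (cmod (f z)) \<le> esssup circle (\<lambda>z. ereal (cmod (f z)))"
    by (rule esssup_AE)
  then show ?thesis
    unfolding Linf_norm_def
  proof eventually_elim
    case (elim z)
    then show ?case
      using fin by (cases "esssup circle (\<lambda>z. ereal (cmod (f z)))") auto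
  qed
qed

lemma wiener_subset_Linf:
  assumes f: "f \<in> wiener"
  shows "f \<in> Linf" "Linf_norm f \<le> wiener_norm f"
  using LinfI Linf_norm_le L1_measurable wiener_AE_bound[OF f] f by (auto simp: wiener_def)

lemma bounded_operators_wiener_Linf:
  "bounded_operators X normX wiener wiener_norm \<subseteq> bounded_operators X normX Linf Linf_norm"
proof
  fix T assume T: "T \<in> bounded_operators X normX wiener wiener_norm"
  then obtain C where C: "\<forall>f\<in>X. wiener_norm (T f) \<le> C * normX f"
    unfolding bounded_operators_def by blast
  have TX: "\<forall>f\<in>X. T f \<in> wiener" using T unfolding bounded_operators_def by blast
  have "\<forall>f\<in>X. Linf_norm (T f) \<le> C * normX f"
    using C TX wiener_subset_Linf(2) by (meson order_trans)
  then show "T \<in> bounded_operators X normX Linf Linf_norm"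
    using T TX wiener_subset_Linf(1) unfolding bounded_operators_def by blast
qed

section \<open>The Hankel operator on analytic polynomials\<close>

lemma analytic_poly_L2: "(\<lambda>z. \<Sum>n<N. a n * z ^ n) \<in> L2"
  using trig_poly_L2[of a int "{..<N}"] by simp

lemma fourier_coeff_analytic_poly:
  "fourier_coeff (\<lambda>z. \<Sum>n<N. a n * z ^ n) (int m) = (if m < N then a m else 0)"
  using fourier_coeff_trig_poly[of a int "{..<N}" "int m"] by simp

lemma analytic_poly_H2: "(\<lambda>z. \<Sum>n<N. a n * z ^ n) \<in> H2"
proof -
  let ?b = "\<lambda>n. if n < N then a n else 0"
  have "(\<lambda>M. L2_norm (\<lambda>z. (\<Sum>n<N. a n * z ^ n) - (\<Sum>n<M. ?b n * z ^ n))) \<longlonglongrightarrow> 0"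
  proof (rule tendsto_eventually, rule eventually_sequentiallyI[of N])
    fix M assume "N \<le> M"
    then have "(\<Sum>n<M. ?b n * z ^ n) = (\<Sum>n<N. a n * z ^ n)" for z
      by (intro sum.mono_neutral_cong_right) auto
    then show "L2_norm (\<lambda>z. (\<Sum>n<N. a n * z ^ n) - (\<Sum>n<M. ?b n * z ^ n)) = 0"
      by (simp add: L2_norm_def)
  qed
  moreover have "summable (\<lambda>n. (cmod (?b n))\<^sup>2)"
    by (rule summable_finite[of "{..<N}"]) auto
  ultimately show ?thesis
    unfolding H2_def mem_Collect_eq using analytic_poly_L2[of a N] by (intro conjI exI[of _ ?b])
qed

lemma H2_norm_analytic_poly: "H2_norm (\<lambda>z. \<Sum>n<N. a n * z ^ n) = sqrt (\<Sum>n<N. (cmod (a n))\<^sup>2)"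
proof -
  have "(\<Sum>n. (cmod (fourier_coeff (\<lambda>z. \<Sum>n<N. a n * z ^ n) (int n)))\<^sup>2) = (\<Sum>n<N. (cmod (a n))\<^sup>2)"
    by (subst suminf_finite[of "{..<N}"]) (auto simp: fourier_coeff_analytic_poly)
  then show ?thesis by (simp add: H2_norm_def)
qed

lemma analytic_polyI: "(\<lambda>z. \<Sum>n<N. a n * z ^ n) \<in> analytic_trig_polys"
  unfolding analytic_trig_polys_def by blast

lemma monomial_H2: "(\<lambda>z. z ^ n) \<in> H2" and monomial_analytic: "(\<lambda>z. z ^ n) \<in> analytic_trig_polys"
proof -
  have eq: "(\<lambda>z. z ^ n) = (\<lambda>z::complex. \<Sum>k<Suc n. (if k = n then 1 else 0) * z ^ k)"
    by (simp add: if_distrib[of "\<lambda>x. x * _"] cong: if_cong)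
  show "(\<lambda>z. z ^ n) \<in> H2" by (subst eq) (rule analytic_poly_H2)
  show "(\<lambda>z. z ^ n) \<in> analytic_trig_polys"
    by (subst eq) (rule analytic_polyI)
qed

lemma mult_analytic_poly_L2:
  assumes "\<phi> \<in> L2"
  shows "(\<lambda>z. \<phi> z * (\<Sum>n<N. a n * z ^ n)) \<in> L2"
  using L2_mult_bounded[OF assms trig_poly_measurable trig_poly_bounded, of a int "{..<N}"] by simp

lemma fourier_coeff_mult_analytic_poly:
  assumes "\<phi> \<in> L1"
  shows "fourier_coeff (\<lambda>z. \<phi> z * (\<Sum>n<N. a n * z ^ n)) m = (\<Sum>n<N. a n * fourier_coeff \<phi> (m - int n))"
proof -
  have "fourier_coeff (\<lambda>z. \<phi> z * (\<Sum>n<N. a n * z ^ n)) m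
      = (LINT z|circle. (\<Sum>n<N. a n * (\<phi> z * z powi (int n - m))))"
    unfolding fourier_coeff_def
    by (intro Bochner_Integration.integral_cong)
       (auto simp: sum_distrib_left sum_distrib_right mult_ac
             simp flip: powi_mult_sphere[of _ "int _" "- m", simplified] intro!: sum.cong)
  also have "\<dots> = (\<Sum>n<N. (LINT z|circle. a n * (\<phi> z * z powi (int n - m))))"
    using integrable_mult_powi[OF assms] by (intro Bochner_Integration.integral_sum) simp
  also have "\<dots> = (\<Sum>n<N. a n * fourier_coeff \<phi> (m - int n))"
    by (simp add: fourier_coeff_def)
  finally show ?thesis .
qed

lemma
  assumes \<phi>: "\<phi> \<in> L2"
  shows hankel_analytic_poly_L2: "hankel \<phi> (\<lambda>z. \<Sum>n<N. a n * z ^ n) \<in> L2"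
    and fourier_coeff_hankel_analytic_poly:
      "fourier_coeff (hankel \<phi> (\<lambda>z. \<Sum>n<N. a n * z ^ n)) m
        = (if m \<le> 0 then \<Sum>n<N. a n * fourier_coeff \<phi> (m - int n) else 0)"
  unfolding hankel_def
  using R_minus_L2[OF mult_analytic_poly_L2[OF \<phi>]] fourier_coeff_R_minus[OF mult_analytic_poly_L2[OF \<phi>]]
    fourier_coeff_mult_analytic_poly[OF L2_subset_L1[OF \<phi>]]
  by simp_all

lemma
  assumes \<phi>: "\<phi> \<in> L2"
  shows hankel_monomial_L2: "hankel \<phi> (\<lambda>z. z ^ n) \<in> L2"
    and fourier_coeff_hankel_monomial:
      "fourier_coeff (hankel \<phi> (\<lambda>z. z ^ n)) m = (if m \<le> 0 then fourier_coeff \<phi> (m - int n) else 0)"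
proof -
  have eq: "(\<lambda>z. z ^ n) = (\<lambda>z::complex. \<Sum>k<Suc n. (if k = n then 1 else 0) * z ^ k)"
    by (simp add: if_distrib[of "\<lambda>x. x * _"] cong: if_cong)
  show "hankel \<phi> (\<lambda>z. z ^ n) \<in> L2"
    unfolding eq by (rule hankel_analytic_poly_L2[OF \<phi>])
  show "fourier_coeff (hankel \<phi> (\<lambda>z. z ^ n)) m = (if m \<le> 0 then fourier_coeff \<phi> (m - int n) else 0)"
    unfolding eq fourier_coeff_hankel_analytic_poly[OF \<phi>]
    by (simp add: if_distrib[of "\<lambda>x. x * _"] cong: if_cong)
qed

lemma
  fixes c :: "int \<Rightarrow> real"
  assumes nn: "\<And>n. 0 \<le> c n" and z: "\<And>n. n > 0 \<Longrightarrow> c n = 0"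
  shows summable_on_antianalytic: "c summable_on UNIV \<longleftrightarrow> summable (\<lambda>k. c (- int k))"
    and infsum_antianalytic: "summable (\<lambda>k. c (- int k)) \<Longrightarrow> (\<Sum>\<^sub>\<infinity>n. c n) = (\<Sum>k. c (- int k))"
proof -
  have inj: "inj (\<lambda>k. - int k)" by (auto simp: inj_def)
  have outside: "c n = 0" if "n \<notin> range (\<lambda>k. - int k)" for n
  proof (rule z, rule ccontr)
    assume "\<not> n > 0"
    then have "n = - int (nat (- n))" by simp
    then show False using that by blast
  qed
  have "c summable_on UNIV \<longleftrightarrow> c summable_on range (\<lambda>k. - int k)"
    by (rule summable_on_cong_neutral) (use outside in auto)
  also have "\<dots> \<longleftrightarrow> (\<lambda>k. c (- int k)) summable_on UNIV"
    using summable_on_reindex[OF inj, of c] by (simp add: o_def)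
  also have "\<dots> \<longleftrightarrow> summable (\<lambda>k. c (- int k))"
    using nn by (simp add: summable_on_UNIV_nonneg_real_iff)
  finally show "c summable_on UNIV \<longleftrightarrow> summable (\<lambda>k. c (- int k))" .
  assume s: "summable (\<lambda>k. c (- int k))"
  have "(\<Sum>\<^sub>\<infinity>n. c n) = infsum c (range (\<lambda>k. - int k))"
    by (rule infsum_cong_neutral) (use outside in auto)
  also have "\<dots> = (\<Sum>\<^sub>\<infinity>k. c (- int k))"
    using infsum_reindex[OF inj, of c] by (simp add: o_def)
  also have "\<dots> = (\<Sum>k. c (- int k))"
    using s nn by (intro infsumI norm_summable_imp_has_sum) (auto intro: summable_sums)
  finally show "(\<Sum>\<^sub>\<infinity>n. c n) = (\<Sum>k. c (- int k))" .
qed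

section \<open>Boundedness into essentially bounded functions is a Hilbert-Schmidt condition\<close>

text \<open>Linearity of an operator holds only up to a null set, so it has to be iterated term by term.\<close>

lemma operator_on_analytic_poly:
  assumes T: "T \<in> bounded_operators H2 H2_norm Y normY"
  shows "ae_eq (T (\<lambda>z. \<Sum>n<N. a n * z ^ n)) (\<lambda>z. \<Sum>n<N. a n * T (\<lambda>z. z ^ n) z)"
proof (induction N)
  have lin: "ae_eq (T (\<lambda>z. s * f z + t * g z)) (\<lambda>z. s * T f z + t * T g z)"
    if "f \<in> H2" "g \<in> H2" for f g s t
    using T that unfolding bounded_operators_def by blast
  case 0
  show ?case
    using lin[OF monomial_H2[of 0] monomial_H2[of 0], of 0 0] by simp
next
  have lin: "ae_eq (T (\<lambda>z. s * f z + t * g z)) (\<lambda>z. s * T f z + t * T g z)"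
    if "f \<in> H2" "g \<in> H2" for f g s t
    using T that unfolding bounded_operators_def by blast
  case (Suc N)
  have "ae_eq (T (\<lambda>z. \<Sum>n<Suc N. a n * z ^ n))
      (\<lambda>z. T (\<lambda>z. \<Sum>n<N. a n * z ^ n) z + a N * T (\<lambda>z. z ^ N) z)"
    using lin[OF analytic_poly_H2[of a N] monomial_H2[of N], of 1 "a N"] by simp
  then show ?case
    using Suc unfolding ae_eq_def by eventually_elim simp
qed

text \<open>Extremality in the Cauchy-Schwarz inequality: \<open>a\<^sub>n = cnj (g\<^sub>n)\<close> would give
  \<open>G \<le> C sqrt G\<close> with \<open>G = \<Sum> \<bar>g\<^sub>n\<bar>\<^sup>2\<close>. This choice need not have its values in \<open>D\<close>, so it is
  reached as a limit of choices that do.\<close>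

lemma sum_square_le_of_dense_bound:
  fixes g :: "nat \<Rightarrow> complex"
  assumes D: "\<And>X. open X \<Longrightarrow> X \<noteq> {} \<Longrightarrow> \<exists>d\<in>D. d \<in> X"
    and le: "\<And>a. a \<in> PiE {..<N} (\<lambda>_. D) \<Longrightarrow> cmod (\<Sum>n<N. a n * g n) \<le> C * sqrt (\<Sum>n<N. (cmod (a n))\<^sup>2)"
  shows "(\<Sum>n<N. (cmod (g n))\<^sup>2) \<le> C\<^sup>2"
proof -
  let ?G = "\<Sum>n<N. (cmod (g n))\<^sup>2"
  have ex: "\<exists>d. d \<in> D \<and> dist d (cnj (g n)) < inverse (real (Suc j))" for n j
    using D[of "ball (cnj (g n)) (inverse (real (Suc j)))"] by (auto simp: dist_commute)
  define d where "d j n = (SOME d. d \<in> D \<and> dist d (cnj (g n)) < inverse (real (Suc j)))" for j n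
  have d: "d j n \<in> D" "dist (d j n) (cnj (g n)) < inverse (real (Suc j))" for n j
    using someI_ex[OF ex[of n j]] by (auto simp: d_def)
  have lim: "(\<lambda>j. d j n) \<longlonglongrightarrow> cnj (g n)" for n
    using d(2) LIMSEQ_inverse_real_of_nat
    by (intro metric_tendsto_imp_tendsto[OF LIMSEQ_inverse_real_of_nat]) (auto intro!: always_eventually less_imp_le)
  have bd: "cmod (\<Sum>n<N. d j n * g n) \<le> C * sqrt (\<Sum>n<N. (cmod (d j n))\<^sup>2)" for j
    using le[of "restrict (d j) {..<N}"] d(1) by simp
  have "(\<lambda>j. cmod (\<Sum>n<N. d j n * g n)) \<longlonglongrightarrow> cmod (\<Sum>n<N. cnj (g n) * g n)"
    and "(\<lambda>j. C * sqrt (\<Sum>n<N. (cmod (d j n))\<^sup>2)) \<longlonglongrightarrow> C * sqrt (\<Sum>n<N. (cmod (cnj (g n)))\<^sup>2)"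
    by (intro tendsto_intros lim)+
  then have "cmod (\<Sum>n<N. cnj (g n) * g n) \<le> C * sqrt (\<Sum>n<N. (cmod (cnj (g n)))\<^sup>2)"
    using bd by (intro LIMSEQ_le) auto
  moreover have "(\<Sum>n<N. cnj (g n) * g n) = of_real ?G"
    by (simp only: of_real_sum complex_norm_square mult.commute)
  moreover have G: "?G \<ge> 0" by (intro sum_nonneg) auto
  ultimately have "?G \<le> C * sqrt ?G"
    by (simp only: norm_of_real complex_mod_cnj abs_of_nonneg)
  then have "sqrt ?G * sqrt ?G \<le> C * sqrt ?G"
    using G by simp
  then have "sqrt ?G \<le> C \<or> ?G = 0"
    using G by (metis mult_right_le_imp_le real_sqrt_gt_zero order_le_less)
  then show ?thesis
    using G by (auto intro: sqrt_le_D)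
qed

text \<open>The exceptional null set in \<open>\<bar>T p\<bar> \<le> C \<parallel>p\<parallel>\<close> depends on the polynomial \<open>p\<close>. Restricting the
  coefficients to a countable dense set leaves a single null set, off which
  \<open>sum_square_le_of_dense_bound\<close> applies.\<close>

lemma hilbert_schmidt_bound:
  assumes \<phi>: "\<phi> \<in> L2" and hb: "hankel_bounded \<phi> Linf Linf_norm"
  shows "\<exists>B. \<forall>N. (\<Sum>n<N. (L2_norm (hankel \<phi> (\<lambda>z. z ^ n)))\<^sup>2) \<le> B"
proof -
  obtain T where T: "T \<in> bounded_operators H2 H2_norm Linf Linf_norm"
    and Th: "\<And>p. p \<in> analytic_trig_polys \<Longrightarrow> ae_eq (T p) (hankel \<phi> p)"
    using hb unfolding hankel_bounded_def by blast
  then obtain C where C: "\<And>f. f \<in> H2 \<Longrightarrow> Linf_norm (T f) \<le> C * H2_norm f" and TL: "\<And>f. f \<in> H2 \<Longrightarrow> T f \<in> Linf"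
    unfolding bounded_operators_def by blast
  define h where "h n = hankel \<phi> (\<lambda>z. z ^ n)" for n
  have hL2: "h n \<in> L2" for n unfolding h_def by (rule hankel_monomial_L2[OF \<phi>])
  have "(\<Sum>n<N. (L2_norm (h n))\<^sup>2) \<le> C\<^sup>2" for N
  proof -
    obtain D :: "complex set" where D: "countable D" "\<And>X. open X \<Longrightarrow> X \<noteq> {} \<Longrightarrow> \<exists>d\<in>D. d \<in> X"
      using countable_dense_setE by blast
    have Th': "AE z in circle. \<forall>n\<in>{..<N}. T (\<lambda>z. z ^ n) z = h n z"
      using Th[OF monomial_analytic] by (intro AE_finite_allI) (auto simp: ae_eq_def h_def)
    have bd: "AE z in circle. cmod (\<Sum>n<N. a n * h n z) \<le> C * sqrt (\<Sum>n<N. (cmod (a n))\<^sup>2)" for a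
    proof -
      have "AE z in circle. cmod (T (\<lambda>z. \<Sum>n<N. a n * z ^ n) z) \<le> Linf_norm (T (\<lambda>z. \<Sum>n<N. a n * z ^ n))"
        by (rule Linf_AE_bound[OF TL[OF analytic_poly_H2]])
      then show ?thesis
        using operator_on_analytic_poly[OF T, of a N, unfolded ae_eq_def] Th'
      proof eventually_elim
        case (elim z)
        then show ?case
          using C[OF analytic_poly_H2[of a N]] by (simp add: H2_norm_analytic_poly)
      qed
    qed
    have "AE z in circle. \<forall>a\<in>PiE {..<N} (\<lambda>_. D). cmod (\<Sum>n<N. a n * h n z) \<le> C * sqrt (\<Sum>n<N. (cmod (a n))\<^sup>2)"
      using bd D(1) by (subst AE_ball_countable) (auto intro: countable_PiE)
    then have "AE z in circle. (\<Sum>n<N. (cmod (h n z))\<^sup>2) \<le> C\<^sup>2"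
      by eventually_elim (rule sum_square_le_of_dense_bound[OF D(2)], auto)
    then have "(LINT z|circle. (\<Sum>n<N. (cmod (h n z))\<^sup>2)) \<le> (LINT z|circle. C\<^sup>2)"
      using L2_square_integrable[OF hL2] by (intro integral_mono_AE) auto
    then show ?thesis
      using L2_square_integrable[OF hL2] circle.prob_space by (simp add: L2_norm_square)
  qed
  then show ?thesis unfolding h_def by blast
qed

text \<open>Each column of the Hankel matrix is bounded by the Bessel inequality. Summing the squared
  entries over the triangle \<open>n + k < N\<close> along antidiagonals counts the coefficient of index
  \<open>- m\<close> exactly \<open>m + 1\<close> times, and \<open>sqrt (1 + m\<^sup>2) \<le> m + 1\<close>.\<close>

theorem hankel_bounded_Linf_imp_sobolev:
  assumes \<phi>: "\<phi> \<in> L2" and hb: "hankel_bounded \<phi> Linf Linf_norm"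
  shows "R_minus \<phi> \<in> sobolev (1 / 2)"
proof -
  obtain B where B: "\<And>N. (\<Sum>n<N. (L2_norm (hankel \<phi> (\<lambda>z. z ^ n)))\<^sup>2) \<le> B"
    using hilbert_schmidt_bound[OF assms] by blast
  define b where "b m = (cmod (fourier_coeff \<phi> (- int m)))\<^sup>2" for m
  have row: "(\<Sum>k<K. b (n + k)) \<le> (L2_norm (hankel \<phi> (\<lambda>z. z ^ n)))\<^sup>2" for n K
    using bessel_inequality[OF hankel_monomial_L2[OF \<phi>], of "(\<lambda>k. - int k) ` {..<K}" n]
    by (simp add: sum.reindex inj_on_def fourier_coeff_hankel_monomial[OF \<phi>] b_def algebra_simps)
  have partial: "(\<Sum>m<N. real (Suc m) * b m) \<le> B" for N
  proof -
    have "(\<Sum>m<N. real (Suc m) * b m) = (\<Sum>m<N. \<Sum>i\<le>m. b (i + (m - i)))"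
      by simp
    also have "\<dots> = (\<Sum>(i, j)\<in>{(i, j). i + j < N}. b (i + j))"
      by (rule sum.triangle_reindex[symmetric])
    also have "\<dots> \<le> (\<Sum>(i, j)\<in>{..<N} \<times> {..<N}. b (i + j))"
      by (intro sum_mono2) (auto simp: b_def)
    also have "\<dots> = (\<Sum>i<N. \<Sum>j<N. b (i + j))"
      by (simp add: sum.cartesian_product)
    also have "\<dots> \<le> (\<Sum>i<N. (L2_norm (hankel \<phi> (\<lambda>z. z ^ i)))\<^sup>2)"
      by (intro sum_mono row)
    finally show ?thesis using B[of N] by simp
  qed
  have "summable (\<lambda>m. real (Suc m) * b m)"
    by (rule summableI_nonneg_bounded[OF _ partial]) (simp add: b_def)
  then have "summable (\<lambda>m. (1 + (real m)\<^sup>2) powr (1 / 2) * b m)"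
  proof (rule summable_comparison_test'[where N = 0])
    fix m
    have "sqrt (1 + (real m)\<^sup>2) \<le> real (Suc m)"
      by (rule real_le_lsqrt) (auto simp: power2_eq_square algebra_simps)
    then show "norm ((1 + (real m)\<^sup>2) powr (1 / 2) * b m) \<le> real (Suc m) * b m"
      by (simp add: powr_half_sqrt b_def mult_right_mono)
  qed
  then show ?thesis
    using L2_subset_L1[OF R_minus_L2[OF \<phi>]]
    by (simp add: sobolev_def summable_on_antianalytic fourier_coeff_R_minus[OF \<phi>] b_def)
qed

section \<open>Hardy's inequality and Hankel forms on sequences\<close>

text \<open>With \<open>A m\<close> the mean of the first \<open>m + 1\<close> terms, \<open>a m = (m + 1) A m - m A (m - 1)\<close>, and completing
  the square shows that \<open>A m\<^sup>2 - 2 A m a m\<close> is at most \<open>m A (m - 1)\<^sup>2 - (m + 1) A m\<^sup>2\<close>. These bounds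
  telescope to \<open>\<Sum> A\<^sup>2 \<le> 2 \<Sum> A a\<close>, and the Cauchy-Schwarz inequality concludes.\<close>

lemma hardy_inequality:
  fixes a :: "nat \<Rightarrow> real"
  shows "(\<Sum>m<N. ((\<Sum>n\<le>m. a n) / real (Suc m))\<^sup>2) \<le> 4 * (\<Sum>m<N. (a m)\<^sup>2)"
proof -
  define A where "A m = (\<Sum>n\<le>m. a n) / real (Suc m)" for m
  define s where "s m = (\<Sum>n<m. a n)" for m
  have A: "A m = s (Suc m) / real (Suc m)" for m
    by (simp add: A_def s_def lessThan_Suc_atMost)
  have tele: "(\<Sum>m<N. (A m)\<^sup>2 - 2 * A m * a m) \<le> - (s N)\<^sup>2 / real N" for N
  proof (induction N)
    case 0
    then show ?case by simp
  next
    case (Suc N)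
    define B where "B = s N / real N"
    \<comment> \<open>For \<open>N = 0\<close> the quotient defining \<open>B\<close> has denominator zero, but then \<open>s N = 0\<close> as well.\<close>
    have sN: "s N = real N * B" by (cases "N = 0") (simp_all add: B_def s_def)
    have sq: "(s N)\<^sup>2 / real N = real N * B\<^sup>2"
      by (cases "N = 0") (simp_all add: B_def power2_eq_square)
    have sS: "s (Suc N) = real (Suc N) * A N" by (simp add: A)
    have a: "a N = real (Suc N) * A N - real N * B"
      using sS sN by (simp add: s_def)
    have "(A N)\<^sup>2 - 2 * A N * a N - real N * B\<^sup>2 = - real (Suc N) * (A N)\<^sup>2 - real N * (A N - B)\<^sup>2"
      unfolding a by (simp add: power2_eq_square algebra_simps)
    also have "\<dots> \<le> - real (Suc N) * (A N)\<^sup>2" by simp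
    also have "\<dots> = - (s (Suc N))\<^sup>2 / real (Suc N)"
      by (simp add: sS power_mult_distrib power2_eq_square[of "real (Suc N)"] del: of_nat_Suc)
    finally show ?case using Suc sq by simp
  qed
  define U V W where "U = (\<Sum>m<N. (A m)\<^sup>2)" and "V = (\<Sum>m<N. (a m)\<^sup>2)" and "W = (\<Sum>m<N. A m * a m)"
  have "U - 2 * W = (\<Sum>m<N. (A m)\<^sup>2 - 2 * A m * a m)"
    by (simp add: U_def W_def sum_subtractf sum_distrib_left mult.assoc)
  also have "\<dots> \<le> 0"
    using tele[of N] by (rule order_trans) simp
  finally have "U \<le> 2 * W" by simp
  moreover have U0: "U \<ge> 0" by (simp add: U_def sum_nonneg)
  ultimately have "U\<^sup>2 \<le> (2 * W)\<^sup>2" by (intro power_mono)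
  also have "\<dots> \<le> 4 * (U * V)"
    using Cauchy_Schwarz_ineq_sum[of A a "{..<N}"] by (simp add: U_def V_def W_def power_mult_distrib)
  finally have "U * U \<le> U * (4 * V)" by (simp add: power2_eq_square algebra_simps)
  moreover have "V \<ge> 0" by (simp add: V_def sum_nonneg)
  ultimately have "U \<le> 4 * V"
    using U0 by (cases "U = 0") auto
  then show ?thesis by (simp add: U_def V_def A_def)
qed

text \<open>Enlarging the rectangle to a triangle and summing along antidiagonals turns the form into
  \<open>\<Sum> (m + 1) b m A m\<close> with \<open>A m\<close> the mean of \<open>a 0, \<dots>, a m\<close>; the Cauchy-Schwarz inequality and
  Hardy's inequality bound it, the constant 2 being the square root of the 4 in the latter.\<close>

lemma hankel_form_rectangle_bound:
  fixes a b :: "nat \<Rightarrow> real"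
  assumes nn: "\<And>m. 0 \<le> b m" "\<And>n. 0 \<le> a n"
    and b: "summable (\<lambda>m. (real (Suc m) * b m)\<^sup>2)" and a: "summable (\<lambda>n. (a n)\<^sup>2)"
  shows "(\<Sum>k<K. \<Sum>n<M. b (k + n) * a n)
      \<le> 2 * sqrt (\<Sum>m. (real (Suc m) * b m)\<^sup>2) * sqrt (\<Sum>n. (a n)\<^sup>2)"
proof -
  define N where "N = K + M"
  define A where "A m = (\<Sum>n\<le>m. a n) / real (Suc m)" for m
  let ?S = "\<Sum>m. (real (Suc m) * b m)\<^sup>2" and ?V = "\<Sum>n. (a n)\<^sup>2"
  have V0: "?V \<ge> 0" and S0: "?S \<ge> 0" using a b by (auto intro: suminf_nonneg)
  have A0: "A m \<ge> 0" for m unfolding A_def using nn by (intro divide_nonneg_nonneg sum_nonneg) auto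
  have "(\<Sum>k<K. \<Sum>n<M. b (k + n) * a n) = (\<Sum>(n, k)\<in>{..<M} \<times> {..<K}. b (k + n) * a n)"
    by (subst sum.swap) (simp add: sum.cartesian_product)
  also have "\<dots> \<le> (\<Sum>(n, k)\<in>{(n, k). n + k < N}. b (k + n) * a n)"
  proof (intro sum_mono2)
    have "{(n, k). n + k < N} \<subseteq> {..<N} \<times> {..<N}" by auto
    then show "finite {(n, k). n + k < N}" by (rule finite_subset) simp
  qed (auto simp: nn N_def)
  also have "\<dots> = (\<Sum>m<N. \<Sum>n\<le>m. b (m - n + n) * a n)"
    by (rule sum.triangle_reindex)
  also have "\<dots> = (\<Sum>m<N. (real (Suc m) * b m) * A m)"
    by (intro sum.cong refl) (simp add: A_def sum_distrib_left[symmetric] del: of_nat_Suc)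
  also have "\<dots> \<le> sqrt ((\<Sum>m<N. (real (Suc m) * b m)\<^sup>2) * (\<Sum>m<N. (A m)\<^sup>2))"
    by (rule real_le_rsqrt[OF Cauchy_Schwarz_ineq_sum])
  also have "\<dots> \<le> sqrt (?S * (4 * ?V))"
  proof (rule real_sqrt_le_mono, rule mult_mono)
    show "(\<Sum>m<N. (real (Suc m) * b m)\<^sup>2) \<le> ?S"
      by (rule sum_le_suminf[OF b]) auto
    have "(\<Sum>m<N. (A m)\<^sup>2) \<le> 4 * (\<Sum>m<N. (a m)\<^sup>2)"
      unfolding A_def by (rule hardy_inequality)
    also have "\<dots> \<le> 4 * ?V"
      using sum_le_suminf[OF a, of "{..<N}"] by simp
    finally show "(\<Sum>m<N. (A m)\<^sup>2) \<le> 4 * ?V" .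
  qed (use S0 in \<open>auto simp: sum_nonneg simp del: of_nat_Suc\<close>)
  also have "\<dots> = 2 * sqrt ?S * sqrt ?V"
    by (simp add: real_sqrt_mult)
  finally show ?thesis .
qed

lemma
  fixes a b :: "nat \<Rightarrow> real"
  assumes nn: "\<And>m. 0 \<le> b m" "\<And>n. 0 \<le> a n"
    and b: "summable (\<lambda>m. (real (Suc m) * b m)\<^sup>2)" and a: "summable (\<lambda>n. (a n)\<^sup>2)"
  shows hankel_form_row_summable: "summable (\<lambda>n. b (k + n) * a n)"
    and hankel_form_summable: "summable (\<lambda>k. \<Sum>n. b (k + n) * a n)"
    and hankel_form_bound: "(\<Sum>k. \<Sum>n. b (k + n) * a n)
      \<le> 2 * sqrt (\<Sum>m. (real (Suc m) * b m)\<^sup>2) * sqrt (\<Sum>n. (a n)\<^sup>2)"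
proof -
  let ?C = "2 * sqrt (\<Sum>m. (real (Suc m) * b m)\<^sup>2) * sqrt (\<Sum>n. (a n)\<^sup>2)"
  note rect = hankel_form_rectangle_bound[OF assms]
  have row: "summable (\<lambda>n. b (k + n) * a n)" for k
  proof (rule summableI_nonneg_bounded)
    show "(\<Sum>n<M. b (k + n) * a n) \<le> ?C" for M
    proof -
      have "(\<Sum>n<M. b (k + n) * a n) \<le> (\<Sum>j<Suc k. \<Sum>n<M. b (j + n) * a n)"
        using nn by (intro member_le_sum[of k "{..<Suc k}" "\<lambda>j. \<Sum>n<M. b (j + n) * a n"] sum_nonneg) auto
      then show ?thesis using rect by (rule order_trans)
    qed
  qed (simp add: nn)
  then show "summable (\<lambda>n. b (k + n) * a n)" .
  have partial: "(\<Sum>k<K. \<Sum>n. b (k + n) * a n) \<le> ?C" for K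
  proof -
    have "(\<Sum>k<K. \<Sum>n. b (k + n) * a n) = (\<Sum>n. \<Sum>k<K. b (k + n) * a n)"
      using row by (intro suminf_sum[symmetric])
    also have "\<dots> \<le> ?C"
    proof (rule suminf_le_const)
      show "summable (\<lambda>n. \<Sum>k<K. b (k + n) * a n)"
        using row by (intro summable_sum)
      show "(\<Sum>n<M. \<Sum>k<K. b (k + n) * a n) \<le> ?C" for M
        using rect[of M K] by (subst sum.swap)
    qed
    finally show ?thesis .
  qed
  show s: "summable (\<lambda>k. \<Sum>n. b (k + n) * a n)"
    by (rule summableI_nonneg_bounded[OF _ partial]) (intro suminf_nonneg row, simp add: nn)
  show "(\<Sum>k. \<Sum>n. b (k + n) * a n) \<le> ?C"
    using s partial by (rule suminf_le_const)
qed

section \<open>Boundedness into the Wiener space\<close>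

text \<open>The matrix of the Hankel operator applied to the coefficients of an arbitrary \<open>f\<close>: unlike the
  product \<open>\<phi> f\<close>, which need not be square-integrable, these series make sense on all of
  \<open>H2\<close>.\<close>

definition hankel_coeff :: "(complex \<Rightarrow> complex) \<Rightarrow> (complex \<Rightarrow> complex) \<Rightarrow> int \<Rightarrow> complex" where
  "hankel_coeff \<phi> f m =
     (if m \<le> 0 then \<Sum>n. fourier_coeff \<phi> (m - int n) * fourier_coeff f (int n) else 0)"

lemma H2_subset_L2: "f \<in> H2 \<Longrightarrow> f \<in> L2"
  by (simp add: H2_def)

lemma summable_square_fourier_coeff:
  assumes "f \<in> L2"
  shows "summable (\<lambda>n. (cmod (fourier_coeff f (int n)))\<^sup>2)"
proof (rule summableI_nonneg_bounded)
  show "(\<Sum>n<N. (cmod (fourier_coeff f (int n)))\<^sup>2) \<le> (L2_norm f)\<^sup>2" for N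
    using bessel_inequality[OF assms, of "int ` {..<N}"] by (simp add: sum.reindex)
qed simp

text \<open>The extension sends \<open>f\<close> to the absolutely convergent Fourier series with coefficients
  \<open>hankel_coeff \<phi> f\<close>. The sequence bounds give its Wiener norm, and uniqueness of Fourier
  coefficients gives linearity and the agreement with the Hankel operator on polynomials.\<close>

theorem sobolev_imp_hankel_bounded_wiener:
  assumes \<phi>: "\<phi> \<in> L2" and sob: "R_minus \<phi> \<in> sobolev 1"
  shows "hankel_bounded \<phi> wiener wiener_norm"
proof -
  define b where "b m = cmod (fourier_coeff \<phi> (- int m))" for m
  have "summable (\<lambda>m. (1 + (real m)\<^sup>2) * (b m)\<^sup>2)"
    using sob by (simp add: sobolev_def summable_on_antianalytic fourier_coeff_R_minus[OF \<phi>] b_def)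
  then have "summable (\<lambda>m. 2 * ((1 + (real m)\<^sup>2) * (b m)\<^sup>2))"
    by (rule summable_mult)
  then have b: "summable (\<lambda>m. (real (Suc m) * b m)\<^sup>2)"
  proof (rule summable_comparison_test'[where N = 0])
    fix m
    have "(real (Suc m))\<^sup>2 \<le> 2 * (1 + (real m)\<^sup>2)"
      using sum_squares_bound[of "real m" 1] by (simp add: power2_eq_square algebra_simps)
    then have "(real (Suc m))\<^sup>2 * (b m)\<^sup>2 \<le> 2 * (1 + (real m)\<^sup>2) * (b m)\<^sup>2"
      by (rule mult_right_mono) simp
    then show "norm ((real (Suc m) * b m)\<^sup>2) \<le> 2 * ((1 + (real m)\<^sup>2) * (b m)\<^sup>2)"
      by (simp only: power_mult_distrib mult.assoc real_norm_def abs_mult abs_power2)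
  qed
  define C where "C = 2 * sqrt (\<Sum>m. (real (Suc m) * b m)\<^sup>2)"
  define c where "c f = hankel_coeff \<phi> f" for f
  have b0: "0 \<le> b m" for m by (simp add: b_def)
  have entry: "cmod (fourier_coeff \<phi> (- int k - int n) * fourier_coeff f (int n))
      = b (k + n) * cmod (fourier_coeff f (int n))" for k n f
    by (simp add: b_def norm_mult)
  have row: "summable (\<lambda>n. cmod (fourier_coeff \<phi> (- int k - int n) * fourier_coeff f (int n)))"
    if "f \<in> L2" for f k
    unfolding entry
    by (rule hankel_form_row_summable[OF b0 norm_ge_zero b summable_square_fourier_coeff[OF that]])
  have row': "summable (\<lambda>n. fourier_coeff \<phi> (m - int n) * fourier_coeff f (int n))"
    if "f \<in> L2" "m \<le> 0" for f m
    using summable_norm_cancel[OF row[OF that(1), of "nat (- m)"]] that(2) by simp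
  have c_le: "cmod (c f (- int k)) \<le> (\<Sum>n. b (k + n) * cmod (fourier_coeff f (int n)))"
    if "f \<in> L2" for f k
    using summable_norm[OF row[OF that, of k]] unfolding entry by (simp add: c_def hankel_coeff_def)
  have c_summable: "(\<lambda>m. cmod (c f m)) summable_on UNIV"
    and c_bound: "(\<Sum>\<^sub>\<infinity>m. cmod (c f m)) \<le> C * H2_norm f" if f: "f \<in> L2" for f
  proof -
    note form = hankel_form_summable[OF b0 norm_ge_zero b summable_square_fourier_coeff[OF f]]
    have s: "summable (\<lambda>k. cmod (c f (- int k)))"
      by (rule summable_comparison_test'[OF form, where N = 0]) (simp add: c_le[OF f])
    have z: "cmod (c f m) = 0" if "m > 0" for m
      using that by (simp add: c_def hankel_coeff_def)
    show "(\<lambda>m. cmod (c f m)) summable_on UNIV"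
      using summable_on_antianalytic[of "\<lambda>m. cmod (c f m)"] s z by simp
    have "(\<Sum>\<^sub>\<infinity>m. cmod (c f m)) = (\<Sum>k. cmod (c f (- int k)))"
      using infsum_antianalytic[of "\<lambda>m. cmod (c f m)"] s z by simp
    also have "\<dots> \<le> (\<Sum>k. \<Sum>n. b (k + n) * cmod (fourier_coeff f (int n)))"
      by (rule suminf_le[OF c_le[OF f] s form])
    also have "\<dots> \<le> C * H2_norm f"
      unfolding C_def H2_norm_def
      by (rule hankel_form_bound[OF b0 norm_ge_zero b summable_square_fourier_coeff[OF f]])
    finally show "(\<Sum>\<^sub>\<infinity>m. cmod (c f m)) \<le> C * H2_norm f" .
  qed
  define T where "T f = wiener_series (c f)" for f
  have TL1: "T f \<in> L1" and Tc: "fourier_coeff (T f) m = c f m" if "f \<in> L2" for f m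
    unfolding T_def using c_summable[OF that]
    by (simp_all add: wiener_series_L1 fourier_coeff_wiener_series)
  have "T \<in> bounded_operators H2 H2_norm wiener wiener_norm"
    unfolding bounded_operators_def mem_Collect_eq
  proof (intro conjI ballI allI impI exI[of _ C])
    fix f assume "f \<in> H2"
    then have f: "f \<in> L2" by (rule H2_subset_L2)
    show "T f \<in> wiener" "wiener_norm (T f) \<le> C * H2_norm f"
      using wiener_series_wiener[OF c_summable[OF f]] c_bound[OF f] by (simp_all add: T_def)
    fix g assume "g \<in> H2"
    then have g: "g \<in> L2" by (rule H2_subset_L2)
    show "ae_eq (T f) (T g)" if "ae_eq f g"
    proof -
      have "fourier_coeff f = fourier_coeff g"
        using fourier_coeff_AE_cong[OF that L2_measurable[OF f] L2_measurable[OF g]] by (rule ext)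
      then have "c f = c g"
        by (simp add: c_def hankel_coeff_def fun_eq_iff)
      then show ?thesis by (simp add: T_def ae_eq_def)
    qed
    show "ae_eq (T (\<lambda>z. s * f z + t * g z)) (\<lambda>z. s * T f z + t * T g z)" for s t
    proof (rule fourier_coeff_inject)
      have fg: "(\<lambda>z. s * f z + t * g z) \<in> L2" by (intro L2_add L2_cmult f g)
      show "T (\<lambda>z. s * f z + t * g z) \<in> L1" by (rule TL1[OF fg])
      show "(\<lambda>z. s * T f z + t * T g z) \<in> L1" by (intro L1_add L1_cmult TL1 f g)
      fix m
      have lin: "fourier_coeff (\<lambda>z. s * u z + t * v z) n = s * fourier_coeff u n + t * fourier_coeff v n"
        if "u \<in> L1" "v \<in> L1" for u v n
        using that by (simp add: fourier_coeff_add L1_cmult fourier_coeff_cmult)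
      have "c (\<lambda>z. s * f z + t * g z) m = s * c f m + t * c g m"
      proof (cases "m \<le> 0")
        case True
        note rf = row'[OF f True] and rg = row'[OF g True]
        have "c (\<lambda>z. s * f z + t * g z) m
          = (\<Sum>n. s * (fourier_coeff \<phi> (m - int n) * fourier_coeff f (int n))
                + t * (fourier_coeff \<phi> (m - int n) * fourier_coeff g (int n)))"
          using True f g
          by (simp add: c_def hankel_coeff_def lin L2_subset_L1 algebra_simps)
        also have "\<dots> = s * c f m + t * c g m"
          using True suminf_add[OF summable_mult[OF rf, of s] summable_mult[OF rg, of t]]
          by (simp add: c_def hankel_coeff_def suminf_mult rf rg)
        finally show ?thesis .
      qed (simp add: c_def hankel_coeff_def)
      then show "fourier_coeff (T (\<lambda>z. s * f z + t * g z)) m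
          = fourier_coeff (\<lambda>z. s * T f z + t * T g z) m"
        by (simp add: Tc fg lin TL1 f g)
    qed
  qed
  moreover have "ae_eq (T p) (hankel \<phi> p)" if p_poly: "p \<in> analytic_trig_polys" for p
  proof -
    obtain a N where p: "p = (\<lambda>z. \<Sum>n<N. a n * z ^ n)"
      using p_poly unfolding analytic_trig_polys_def by blast
    have pL2: "p \<in> L2" unfolding p by (rule analytic_poly_L2)
    have "c p m = fourier_coeff (hankel \<phi> p) m" for m
      unfolding c_def hankel_coeff_def p fourier_coeff_hankel_analytic_poly[OF \<phi>] fourier_coeff_analytic_poly
      by (subst suminf_finite[of "{..<N}"]) (auto simp: mult.commute)
    then show ?thesis
      using TL1[OF pL2] Tc[OF pL2] L2_subset_L1[OF hankel_analytic_poly_L2[OF \<phi>, of a N]]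
      by (intro fourier_coeff_inject) (auto simp: p)
  qed
  ultimately show ?thesis
    unfolding hankel_bounded_def by blast
qed

theorem proposition1p17:
  fixes \<phi> :: "complex \<Rightarrow> complex"
  assumes "\<phi> \<in> L2"
  shows "(hankel_bounded \<phi> Linf Linf_norm \<longrightarrow> R_minus \<phi> \<in> sobolev (1 / 2)) \<and>
         (R_minus \<phi> \<in> sobolev 1 \<longrightarrow> hankel_bounded \<phi> wiener wiener_norm) \<and>
         bounded_operators H2 H2_norm wiener wiener_norm \<subseteq> bounded_operators H2 H2_norm Linf Linf_norm"
  using hankel_bounded_Linf_imp_sobolev[OF assms] sobolev_imp_hankel_bounded_wiener[OF assms]
    bounded_operators_wiener_Linf
  by blast

end
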